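(* Let $r\in\mathbb R$, $s\ge r$ and $\alpha>0$, and suppose $g\in H^r(\mathbb T^2\times Q)$. Then the minimization problem $$\operatorname*{arg\,min}_{f\in H^r(\mathbb T^2)}\left(\|If-g\|^2_{H^r(\mathbb T^2\times Q)}+\alpha\|f\|^2_{H^s(\mathbb T^2)}\right)$$ has a unique minimizer, and it is $f=P^{s-r}_\alpha I^*g\in H^{2s-r}(\mathbb T^2)\subset H^s(\mathbb T^2)$.
   Context: $\mathbb T^2=\mathbb R^2/\mathbb Z^2$, and $\mathcal T'$ is the space of distributions on $\mathbb T^2$ (dual of $C^\infty(\mathbb T^2)$), with Fourier coefficients $\hat f(k)=f(e^{-2\pi i k\cdot x})$, $k\in\mathbb Z^2$. Write $\langle k\rangle=(1+|k|^2)^{1/2}$. For $s\in\mathbb R$, $H^s(\mathbb T^2)$ is the space of $f\in\mathcal T'$ with finite norm $\|f\|^2_{H^s(\mathbb T^2)}=\sum_{k\in\mathbb Z^2}\langle k\rangle^{2s}|\hat f(k)|^2$; the norm is $+\infty$ if $f\notin H^s(\mathbb T^2)$. Fix $Q\subset\mathbb Z^2\setminus\{0\}$ such that every nonzero $v\in\mathbb Z^2$ is an integer multiple of a unique element of $Q$. For $s\in\mathbb R$, $H^s(\mathbb T^2\times Q)$ is the set of $g$ on $\mathbb T^2\times Q$ such that $g(\cdot,v)\in H^s(\mathbb T^2)$ for every $v\in Q$, the average (zeroth Fourier coefficient) of $g(\cdot,v)$ over $\mathbb T^2$ is the same for all $v\in Q$ (denoted $\hat g(0,0)$), and the norm $$\|g\|^2_{H^s(\mathbb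 T^2\times Q)}=|\hat g(0,0)|^2+\sum_{k\in\mathbb Z^2\setminus 0}\sum_{v\in Q}\langle k\rangle^{2s}|\hat g(k,v)|^2$$ is finite, where $\hat g(k,v)$ is the $k$-th Fourier coefficient of $g(\cdot,v)$. The X-ray transform is $If(x,v)=\int_0^1 f(x+tv)\,dt$ for continuous $f$, extended to $f\in\mathcal T'$ for each fixed $v$ by duality, using that $If(\cdot,v)$ is formally $L^2(\mathbb T^2)$ self-adjoint; equivalently $\widehat{If}(k,v)=\hat f(k)$ if $k\cdot v=0$ and $\widehat{If}(k,v)=0$ otherwise. $I^*$ is the Hilbert space adjoint of $I:H^r(\mathbb T^2)\to H^r(\mathbb T^2\times Q)$. For $\sigma\in\mathbb R$, $P^\sigma_\alpha$ is the Fourier multiplier with symbol $(1+\alpha\langle k\rangle^{2\sigma})^{-1}$, i.e. $\widehat{P^\sigma_\alpha f}(k)=(1+\alpha\langle k\rangle^{2\sigma})^{-1}\hat f(k)$. *)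

theory Defs
  imports "HOL-Analysis.Analysis"
begin

text \<open>
  Functions on the torus \<open>\<real>\<^sup>2/\<int>\<^sup>2\<close> are represented by \<open>\<int>\<^sup>2\<close>-periodic functions on
  \<open>\<real> \<times> \<real>\<close>, whose norm and inner product are the Euclidean ones.
\<close>

type_synonym torus_fun = "real \<times> real \<Rightarrow> complex"

definition emb :: "int \<times> int \<Rightarrow> real \<times> real" where
  "emb k = (real_of_int (fst k), real_of_int (snd k))"

definition periodic :: "torus_fun \<Rightarrow> bool" where
  "periodic \<phi> \<longleftrightarrow> (\<forall>x k. \<phi> (x + emb k) = \<phi> x)"

definition partial1 :: "torus_fun \<Rightarrow> torus_fun" where
  "partial1 \<phi> = (\<lambda>x. frechet_derivative \<phi> (at x) (1, 0))"

definition partial2 :: "torus_fun \<Rightarrow> torus_fun" where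
  "partial2 \<phi> = (\<lambda>x. frechet_derivative \<phi> (at x) (0, 1))"

fun C_k :: "nat \<Rightarrow> torus_fun \<Rightarrow> bool" where
  "C_k 0 \<phi> \<longleftrightarrow> continuous_on UNIV \<phi>"
| "C_k (Suc n) \<phi> \<longleftrightarrow>
     (\<forall>x. \<phi> differentiable (at x)) \<and> C_k n (partial1 \<phi>) \<and> C_k n (partial2 \<phi>)"

definition test_fun :: "torus_fun set" where
  "test_fun = {\<phi>. periodic \<phi> \<and> (\<forall>n. C_k n \<phi>)}"

definition C_norm :: "nat \<Rightarrow> torus_fun \<Rightarrow> real" where
  "C_norm N \<phi> = (\<Sum>(a, b) \<in> {(a, b). a + b \<le> N}.
      SUP x. norm ((partial1 ^^ a) ((partial2 ^^ b) \<phi>) x))"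

text \<open>
  The space of distributions is the dual of the Frechet space of smooth functions, whose
  topology is given by the increasing sequence of norms \<^term>\<open>C_norm\<close>. A distribution is
  defined on test functions only; since HOL functions are total it is extended by \<open>0\<close> to
  all other functions, so that equality of distributions is equality in HOL and differences
  of distributions are pointwise differences.
\<close>

type_synonym functional = "torus_fun \<Rightarrow> complex"

definition distributions :: "functional set" where
  "distributions = {u.
      (\<forall>\<phi>\<in>test_fun. \<forall>\<psi>\<in>test_fun. u (\<lambda>x. \<phi> x + \<psi> x) = u \<phi> + u \<psi>) \<and>
      (\<forall>\<phi>\<in>test_fun. \<forall>c. u (\<lambda>x. c * \<phi> x) = c * u \<phi>) \<and>
      (\<exists>N C. \<forall>\<phi>\<in>test_fun. norm (u \<phi>) \<le> C * C_norm N \<phi>) \<and>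
      (\<forall>\<phi>. \<phi> \<notin> test_fun \<longrightarrow> u \<phi> = 0)}"

definition fourier :: "functional \<Rightarrow> int \<times> int \<Rightarrow> complex" where
  "fourier u k = u (\<lambda>x. exp (- 2 * complex_of_real pi * \<i> * complex_of_real (emb k \<bullet> x)))"

definition jbracket :: "int \<times> int \<Rightarrow> real" where
  "jbracket k = sqrt (1 + (norm (emb k))\<^sup>2)"

definition sobolev_normsq :: "real \<Rightarrow> functional \<Rightarrow> ennreal" where
  "sobolev_normsq s f =
     (\<Sum>\<^sub>\<infinity>k. ennreal (jbracket k powr (2 * s) * (cmod (fourier f k))\<^sup>2))"

definition sobolev :: "real \<Rightarrow> functional set" where
  "sobolev s = {f \<in> distributions. sobolev_normsq s f < \<infinity>}"

definition sobolev_inner :: "real \<Rightarrow> functional \<Rightarrow> functional \<Rightarrow> complex" where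
  "sobolev_inner s f h =
     (\<Sum>\<^sub>\<infinity>k. complex_of_real (jbracket k powr (2 * s)) * fourier f k * cnj (fourier h k))"

definition direction_set :: "(int \<times> int) set \<Rightarrow> bool" where
  "direction_set Q \<longleftrightarrow> 0 \<notin> Q \<and>
     (\<forall>v. v \<noteq> 0 \<longrightarrow> (\<exists>!q. q \<in> Q \<and> (\<exists>n::int. v = (n * fst q, n * snd q))))"

text \<open>
  A function \<open>g\<close> on \<open>\<T>\<^sup>2 \<times> Q\<close> is represented by \<open>v \<mapsto> g(\<cdot>, v)\<close>, extended by the zero
  functional to directions outside \<open>Q\<close>. The value of \<open>mean0 Q g\<close> is meaningful
  only when the averages of \<open>g(\<cdot>, v)\<close> agree for all \<open>v\<close> in \<open>Q\<close>.
\<close>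

type_synonym family = "int \<times> int \<Rightarrow> functional"

definition mean0 :: "(int \<times> int) set \<Rightarrow> family \<Rightarrow> complex" where
  "mean0 Q g = (THE c. \<forall>v\<in>Q. fourier (g v) 0 = c)"

definition sobolevQ_normsq :: "(int \<times> int) set \<Rightarrow> real \<Rightarrow> family \<Rightarrow> ennreal" where
  "sobolevQ_normsq Q s g = ennreal ((cmod (mean0 Q g))\<^sup>2) +
     (\<Sum>\<^sub>\<infinity>k\<in>UNIV - {0}. \<Sum>\<^sub>\<infinity>v\<in>Q.
        ennreal (jbracket k powr (2 * s) * (cmod (fourier (g v) k))\<^sup>2))"

definition sobolevQ :: "(int \<times> int) set \<Rightarrow> real \<Rightarrow> family set" where
  "sobolevQ Q s = {g.
      (\<forall>v\<in>Q. g v \<in> sobolev s) \<and>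
      (\<forall>v. v \<notin> Q \<longrightarrow> g v = (\<lambda>\<phi>. 0)) \<and>
      (\<forall>v\<in>Q. \<forall>w\<in>Q. fourier (g v) 0 = fourier (g w) 0) \<and>
      sobolevQ_normsq Q s g < \<infinity>}"

definition sobolevQ_inner :: "(int \<times> int) set \<Rightarrow> real \<Rightarrow> family \<Rightarrow> family \<Rightarrow> complex" where
  "sobolevQ_inner Q s g h = mean0 Q g * cnj (mean0 Q h) +
     (\<Sum>\<^sub>\<infinity>k\<in>UNIV - {0}. \<Sum>\<^sub>\<infinity>v\<in>Q.
        complex_of_real (jbracket k powr (2 * s)) * fourier (g v) k * cnj (fourier (h v) k))"

text \<open>
  \<^term>\<open>xray_fun\<close> is the X-ray transform of a function. For fixed \<open>v\<close> it is symmetric for the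
  bilinear pairing of functions on the torus, hence its extension to distributions is
  the transpose.
\<close>

definition xray_fun :: "torus_fun \<Rightarrow> int \<times> int \<Rightarrow> torus_fun" where
  "xray_fun \<phi> v = (\<lambda>x. integral {0..1} (\<lambda>t. \<phi> (x + t *\<^sub>R emb v)))"

definition xray :: "(int \<times> int) set \<Rightarrow> functional \<Rightarrow> family" where
  "xray Q f = (\<lambda>v \<phi>. if v \<in> Q \<and> \<phi> \<in> test_fun then f (xray_fun \<phi> v) else 0)"

text \<open>
  The Hilbert space adjoint with respect to the inner products \<^term>\<open>sobolev_inner r\<close> and
  \<^term>\<open>sobolevQ_inner Q r\<close> (linear in the first argument), which induce the given norms.
\<close>

definition xray_adjoint :: "(int \<times> int) set \<Rightarrow> real \<Rightarrow> family \<Rightarrow> functional" where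
  "xray_adjoint Q r g = (THE h. h \<in> sobolev r \<and>
     (\<forall>f\<in>sobolev r. sobolevQ_inner Q r (xray Q f) g = sobolev_inner r f h))"

definition P_op :: "real \<Rightarrow> real \<Rightarrow> functional \<Rightarrow> functional" where
  "P_op \<sigma> \<alpha> f = (THE h. h \<in> distributions \<and>
     (\<forall>k. fourier h k = complex_of_real (inverse (1 + \<alpha> * jbracket k powr (2 * \<sigma>))) * fourier f k))"

text \<open>The value is \<open>\<infinity>\<close> when \<open>f\<close> is not in \<open>H\<^sup>s\<close>, as \<open>\<alpha> > 0\<close>.\<close>

definition tikhonov ::
  "(int \<times> int) set \<Rightarrow> real \<Rightarrow> real \<Rightarrow> real \<Rightarrow> family \<Rightarrow> functional \<Rightarrow> ennreal" where
  "tikhonov Q r s \<alpha> g f =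
     sobolevQ_normsq Q r (\<lambda>v \<phi>. xray Q f v \<phi> - g v \<phi>) + ennreal \<alpha> * sobolev_normsq s f"

end

theory Submission
  imports Defs
begin

text \<open>
  On the Fourier side the minimisation problem decouples. For \<open>k \<noteq> 0\<close> the X-ray transform in
  direction \<open>v\<close> keeps the coefficient at \<open>k\<close> if \<open>k\<close> is perpendicular to \<open>v\<close> and kills it
  otherwise, and exactly one direction in \<open>Q\<close> is perpendicular to \<open>k\<close>
  (\<open>ex1_perpendicular_direction\<close>). So the data enter the functional through a single number
  \<open>b k = perp_coef Q g k\<close> per frequency, plus a part \<open>offperp_normsq\<close> that no choice of \<open>f\<close> can
  change; these \<open>b k\<close> are also the Fourier coefficients of the adjoint
  (\<open>xray_adjoint_fourier\<close>). What remains is a sum over \<open>k\<close> of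
  \<open>A |z - b|\<^sup>2 + B |z|\<^sup>2\<close> with \<open>z\<close> the coefficient of \<open>f\<close>, \<open>A = \<langle>k\<rangle>\<^bsup>2r\<^esup>\<close> and
  \<open>B = \<alpha> \<langle>k\<rangle>\<^bsup>2s\<^esup>\<close>. Completing the square (\<open>tikhonov_complete_square\<close>) writes the functional as
  a finite constant plus a positively weighted sum of the squared distances between the coefficients
  of \<open>f\<close> and the numbers \<open>A b / (A + B)\<close>, which are the coefficients of
  \<open>P_op (s - r) \<alpha> (xray_adjoint Q r g)\<close>. This gives existence, uniqueness and the formula at once,
  and the factor \<open>A / (A + B)\<close> decays fast enough to gain \<open>2 (s - r)\<close> derivatives.

  To speak of distributions through their coefficients, two facts about Fourier series are used: a
  distribution is determined by its coefficients (\<open>distribution_eqI\<close>), and every sequence of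
  polynomial growth is the coefficient sequence of a distribution (\<open>distribution_with_fourier\<close>).
  Both rest on the Fourier series of a smooth periodic function. Integration by parts makes its
  coefficients decay faster than any power of \<open>k\<close> (\<open>coef_decay\<close>), which gives the second fact and
  uniform convergence of the series. The limit is the function itself because a continuous periodic
  function with vanishing coefficients is zero (\<open>coef_eq_0_imp_eq_0\<close>), a consequence of the
  Stone-Weierstrass theorem on the torus embedded in \<open>\<complex> \<times> \<complex>\<close>. Since the coefficients of a
  derivative are multiples of the original ones, the series converges together with all its
  derivatives, that is, in the topology of test functions, and the first fact follows.
\<close>

section \<open>Characters and the algebra of test functions\<close>

(* Points and frequencies are pairs. Splitting quantified pairs into components would
   keep facts about an undivided point from matching. *)
declare split_paired_All [simp del] split_paired_Ex [simp del]

definition character :: "int \<times> int \<Rightarrow> torus_fun" where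
  "character k = (\<lambda>x. exp (- 2 * complex_of_real pi * \<i> * complex_of_real (emb k \<bullet> x)))"

definition freq1 :: "int \<times> int \<Rightarrow> complex" where
  "freq1 k = - 2 * complex_of_real pi * \<i> * of_int (fst k)"

definition freq2 :: "int \<times> int \<Rightarrow> complex" where
  "freq2 k = - 2 * complex_of_real pi * \<i> * of_int (snd k)"

lemma fourier_eq_character: "fourier u k = u (character k)"
  by (simp add: fourier_def character_def)

lemma emb_add: "emb (j + k) = emb j + emb k"
  by (simp add: emb_def)

lemma emb_minus: "emb (- k) = - emb k"
  by (simp add: emb_def)

lemma emb_zero [simp]: "emb 0 = 0"
  by (simp add: emb_def zero_prod_def)

lemma emb_inner: "emb j \<bullet> emb k = of_int (fst j * fst k + snd j * snd k)"
  by (simp add: emb_def)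

lemma character_zero [simp]: "character 0 x = 1"
  by (simp add: character_def)

lemma character_add: "character (j + k) x = character j x * character k x"
  by (simp add: character_def emb_add inner_add_left distrib_left flip: exp_add)

lemma character_translate: "character k (x + y) = character k x * character k y"
  by (simp add: character_def inner_add_right distrib_left flip: exp_add)

lemma character_emb [simp]: "character k (emb j) = 1"
proof -
  have "character k (emb j) = exp (complex_of_real (2 * of_int (- (fst k * fst j + snd k * snd j)) * pi) * \<i>)"
    by (simp add: character_def emb_inner algebra_simps)
  also have "\<dots> = 1"
    unfolding exp_eq_1 by (intro conjI exI[of _ "- (fst k * fst j + snd k * snd j)"]) auto
  finally show ?thesis .
qed

lemma norm_character [simp]: "cmod (character k x) = 1"
proof -
  have "character k x = exp (\<i> * complex_of_real (- 2 * pi * (emb k \<bullet> x)))"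
    by (simp add: character_def algebra_simps)
  then show ?thesis by (simp only: norm_exp_i_times)
qed

lemma periodic_character: "periodic (character k)"
  by (simp add: periodic_def character_translate)

lemma character_has_derivative:
  "(character k has_derivative
     (\<lambda>h. - 2 * complex_of_real pi * \<i> * complex_of_real (emb k \<bullet> h) * character k x)) (at x)"
proof -
  have "bounded_linear (\<lambda>h. - 2 * complex_of_real pi * \<i> * complex_of_real (emb k \<bullet> h))"
    by (intro bounded_linear_const_mult bounded_linear_compose[OF bounded_linear_of_real]
        bounded_linear_inner_right)
  from has_derivative_compose[OF bounded_linear_imp_has_derivative[OF this]
      DERIV_exp[THEN has_field_derivative_imp_has_derivative]]
  show ?thesis
    unfolding character_def by (simp add: mult.commute)
qed

lemma continuous_on_character [continuous_intros]: "continuous_on S (character k)"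
  unfolding character_def by (intro continuous_intros)

text \<open>
  The partial derivatives are defined from the Frechet derivative, so any known derivative
  determines them by uniqueness.
\<close>

lemma partial1_eqI: "(\<And>x. (\<phi> has_derivative D x) (at x)) \<Longrightarrow> partial1 \<phi> = (\<lambda>x. D x (1, 0))"
  unfolding partial1_def by (intro ext) (metis frechet_derivative_at)

lemma partial2_eqI: "(\<And>x. (\<phi> has_derivative D x) (at x)) \<Longrightarrow> partial2 \<phi> = (\<lambda>x. D x (0, 1))"
  unfolding partial2_def by (intro ext) (metis frechet_derivative_at)

lemma partial1_add:
  assumes "\<And>x. \<phi> differentiable (at x)" "\<And>x. \<psi> differentiable (at x)"
  shows "partial1 (\<lambda>x. \<phi> x + \<psi> x) = (\<lambda>x. partial1 \<phi> x + partial1 \<psi> x)"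
  using partial1_eqI[OF has_derivative_add[OF assms[unfolded frechet_derivative_works]]]
  by (simp add: partial1_def)

lemma partial2_add:
  assumes "\<And>x. \<phi> differentiable (at x)" "\<And>x. \<psi> differentiable (at x)"
  shows "partial2 (\<lambda>x. \<phi> x + \<psi> x) = (\<lambda>x. partial2 \<phi> x + partial2 \<psi> x)"
  using partial2_eqI[OF has_derivative_add[OF assms[unfolded frechet_derivative_works]]]
  by (simp add: partial2_def)

lemma partial1_mult:
  assumes "\<And>x. \<phi> differentiable (at x)" "\<And>x. \<psi> differentiable (at x)"
  shows "partial1 (\<lambda>x. \<phi> x * \<psi> x) = (\<lambda>x. \<phi> x * partial1 \<psi> x + partial1 \<phi> x * \<psi> x)"
  using partial1_eqI[OF has_derivative_mult[OF assms[unfolded frechet_derivative_works]]]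
  by (simp add: partial1_def)

lemma partial2_mult:
  assumes "\<And>x. \<phi> differentiable (at x)" "\<And>x. \<psi> differentiable (at x)"
  shows "partial2 (\<lambda>x. \<phi> x * \<psi> x) = (\<lambda>x. \<phi> x * partial2 \<psi> x + partial2 \<phi> x * \<psi> x)"
  using partial2_eqI[OF has_derivative_mult[OF assms[unfolded frechet_derivative_works]]]
  by (simp add: partial2_def)

lemma partial1_const [simp]: "partial1 (\<lambda>x. c) = (\<lambda>x. 0)"
  and partial2_const [simp]: "partial2 (\<lambda>x. c) = (\<lambda>x. 0)"
  by (simp_all add: partial1_def partial2_def)

lemma partial1_cmult:
  assumes "\<And>x. \<phi> differentiable (at x)"
  shows "partial1 (\<lambda>x. c * \<phi> x) = (\<lambda>x. c * partial1 \<phi> x)"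
  using partial1_mult[of "\<lambda>x. c" \<phi>] assms by simp

lemma partial2_cmult:
  assumes "\<And>x. \<phi> differentiable (at x)"
  shows "partial2 (\<lambda>x. c * \<phi> x) = (\<lambda>x. c * partial2 \<phi> x)"
  using partial2_mult[of "\<lambda>x. c" \<phi>] assms by simp

lemma character_differentiable: "character k differentiable (at x)"
  unfolding differentiable_def using character_has_derivative by blast

lemma partial1_character: "partial1 (character k) = (\<lambda>x. freq1 k * character k x)"
  and partial2_character: "partial2 (character k) = (\<lambda>x. freq2 k * character k x)"
  unfolding partial1_eqI[OF character_has_derivative] partial2_eqI[OF character_has_derivative]
  by (simp_all add: freq1_def freq2_def emb_def)

lemma C_k_add: "C_k n \<phi> \<Longrightarrow> C_k n \<psi> \<Longrightarrow> C_k n (\<lambda>x. \<phi> x + \<psi> x)"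
  by (induction n arbitrary: \<phi> \<psi>) (auto intro: continuous_intros simp: partial1_add partial2_add)

lemma C_k_cmult: "C_k n \<phi> \<Longrightarrow> C_k n (\<lambda>x. c * \<phi> x)"
  by (induction n arbitrary: \<phi>)
    (auto intro: continuous_intros simp: partial1_cmult partial2_cmult)

lemma C_k_character: "C_k n (character k)"
  by (induction n)
    (auto simp: continuous_on_character character_differentiable partial1_character
      partial2_character C_k_cmult)

lemma character_in_test_fun [simp]: "character k \<in> test_fun"
  by (simp add: test_fun_def periodic_character C_k_character)

lemma test_fun_add: "\<phi> \<in> test_fun \<Longrightarrow> \<psi> \<in> test_fun \<Longrightarrow> (\<lambda>x. \<phi> x + \<psi> x) \<in> test_fun"
  by (simp add: test_fun_def C_k_add periodic_def)

lemma test_fun_cmult: "\<phi> \<in> test_fun \<Longrightarrow> (\<lambda>x. c * \<phi> x) \<in> test_fun"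
  by (simp add: test_fun_def C_k_cmult periodic_def)

lemma test_fun_zero: "(\<lambda>x. 0) \<in> test_fun"
  using test_fun_cmult[of "character 0" 0] by simp

lemma test_fun_diff: "\<phi> \<in> test_fun \<Longrightarrow> \<psi> \<in> test_fun \<Longrightarrow> (\<lambda>x. \<phi> x - \<psi> x) \<in> test_fun"
  using test_fun_add[of \<phi> "\<lambda>x. (-1) * \<psi> x"] test_fun_cmult[of \<psi> "-1"] by simp

lemma test_fun_sum:
  "(\<And>k. k \<in> X \<Longrightarrow> \<phi> k \<in> test_fun) \<Longrightarrow> (\<lambda>x. \<Sum>k\<in>X. \<phi> k x) \<in> test_fun"
  by (induction X rule: infinite_finite_induct) (auto simp: test_fun_zero intro: test_fun_add)

lemma test_fun_differentiable: "\<phi> \<in> test_fun \<Longrightarrow> \<phi> differentiable (at x)"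
  unfolding test_fun_def by (metis (no_types, lifting) C_k.simps(2) mem_Collect_eq)

lemma test_fun_continuous: "\<phi> \<in> test_fun \<Longrightarrow> continuous_on S \<phi>"
  unfolding test_fun_def by (metis (no_types, lifting) C_k.simps(1) continuous_on_subset mem_Collect_eq subset_UNIV)

text \<open>
  The derivative of a periodic function is periodic, which keeps the partial derivatives of
  test functions inside the space of test functions.
\<close>

lemma frechet_derivative_translate:
  fixes \<phi> :: torus_fun
  assumes "periodic \<phi>" "\<And>x. \<phi> differentiable (at x)"
  shows "frechet_derivative \<phi> (at (x + emb k)) = frechet_derivative \<phi> (at x)"
proof -
  have "((\<lambda>y. y + emb k) has_derivative (\<lambda>h. h)) (at x)"
    by (auto intro!: derivative_eq_intros)
  from has_derivative_compose[OF this assms(2)[unfolded frechet_derivative_works]]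
  have "((\<lambda>y. \<phi> (y + emb k)) has_derivative frechet_derivative \<phi> (at (x + emb k))) (at x)" .
  then show ?thesis
    using assms(1) by (simp add: periodic_def frechet_derivative_at)
qed

lemma partial1_test_fun: "\<phi> \<in> test_fun \<Longrightarrow> partial1 \<phi> \<in> test_fun"
proof -
  assume \<phi>: "\<phi> \<in> test_fun"
  then have "C_k n (partial1 \<phi>)" for n
    unfolding test_fun_def by (metis (no_types, lifting) C_k.simps(2) mem_Collect_eq)
  with \<phi> show ?thesis
    using frechet_derivative_translate[of \<phi>] test_fun_differentiable[OF \<phi>]
    by (simp add: test_fun_def periodic_def partial1_def)
qed

lemma partial2_test_fun: "\<phi> \<in> test_fun \<Longrightarrow> partial2 \<phi> \<in> test_fun"
proof -
  assume \<phi>: "\<phi> \<in> test_fun"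
  then have "C_k n (partial2 \<phi>)" for n
    unfolding test_fun_def by (metis (no_types, lifting) C_k.simps(2) mem_Collect_eq)
  with \<phi> show ?thesis
    using frechet_derivative_translate[of \<phi>] test_fun_differentiable[OF \<phi>]
    by (simp add: test_fun_def periodic_def partial2_def)
qed

abbreviation deriv_ab :: "nat \<Rightarrow> nat \<Rightarrow> torus_fun \<Rightarrow> torus_fun" where
  "deriv_ab a b \<phi> \<equiv> (partial1 ^^ a) ((partial2 ^^ b) \<phi>)"

lemma deriv_ab_test_fun:
  assumes "\<phi> \<in> test_fun"
  shows "deriv_ab a b \<phi> \<in> test_fun"
proof (induction a)
  case 0
  show ?case
    by (induction b) (simp_all add: assms partial2_test_fun)
next
  case (Suc a)
  then show ?case by (simp add: partial1_test_fun)
qed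

lemma deriv_ab_add:
  assumes "\<phi> \<in> test_fun" "\<psi> \<in> test_fun"
  shows "deriv_ab a b (\<lambda>x. \<phi> x + \<psi> x) = (\<lambda>x. deriv_ab a b \<phi> x + deriv_ab a b \<psi> x)"
proof (induction a)
  case 0
  show ?case
  proof (induction b)
    case (Suc b)
    then show ?case
      using deriv_ab_test_fun[OF assms(1), of 0 b] deriv_ab_test_fun[OF assms(2), of 0 b]
      by (simp add: partial2_add test_fun_differentiable)
  qed simp
next
  case (Suc a)
  then show ?case
    using deriv_ab_test_fun[OF assms(1), of a b] deriv_ab_test_fun[OF assms(2), of a b]
    by (simp add: partial1_add test_fun_differentiable)
qed

lemma deriv_ab_cmult:
  assumes "\<phi> \<in> test_fun"
  shows "deriv_ab a b (\<lambda>x. c * \<phi> x) = (\<lambda>x. c * deriv_ab a b \<phi> x)"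
proof (induction a)
  case 0
  show ?case
  proof (induction b)
    case (Suc b)
    then show ?case
      using deriv_ab_test_fun[OF assms(1), of 0 b] 
      by (simp add: partial2_cmult test_fun_differentiable)
  qed simp
next
  case (Suc a)
  then show ?case
    using deriv_ab_test_fun[OF assms(1), of a b]
    by (simp add: partial1_cmult test_fun_differentiable)
qed

lemma deriv_ab_diff:
  assumes "\<phi> \<in> test_fun" "\<psi> \<in> test_fun"
  shows "deriv_ab a b (\<lambda>x. \<phi> x - \<psi> x) = (\<lambda>x. deriv_ab a b \<phi> x - deriv_ab a b \<psi> x)"
  using deriv_ab_add[OF assms(1) test_fun_cmult[OF assms(2), of "-1"]]
    deriv_ab_cmult[OF assms(2), of _ _ "-1"] by simp

lemma deriv_ab_zero: "deriv_ab a b (\<lambda>x. 0) = (\<lambda>x. 0)"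
  using deriv_ab_cmult[OF test_fun_zero, of a b 0] by simp

lemma deriv_ab_sum:
  assumes "\<And>k. k \<in> X \<Longrightarrow> \<phi> k \<in> test_fun"
  shows "deriv_ab a b (\<lambda>x. \<Sum>k\<in>X. \<phi> k x) = (\<lambda>x. \<Sum>k\<in>X. deriv_ab a b (\<phi> k) x)"
  using assms
  by (induction X rule: infinite_finite_induct)
    (auto simp: deriv_ab_zero deriv_ab_add test_fun_sum)

lemma deriv_ab_character:
  "deriv_ab a b (character k) = (\<lambda>x. freq1 k ^ a * freq2 k ^ b * character k x)"
proof (induction a)
  case 0
  show ?case
    by (induction b)
      (simp_all add: partial2_cmult character_differentiable partial2_character mult.assoc mult.left_commute)
next
  case (Suc a)
  then show ?case
    by (simp add: partial1_cmult character_differentiable partial1_character mult.assoc mult.left_commute)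
qed


section \<open>Fourier coefficients of functions on the torus\<close>

abbreviation unit_square :: "(real \<times> real) set" where
  "unit_square \<equiv> cbox (0, 0) (1, 1)"

text \<open>
  The factor is \<open>character (- k)\<close>, the complex conjugate of \<open>character k\<close>, so that
  \<open>\<phi>\<close> is expanded in the functions \<open>character k\<close>. These have the sign convention
  \<open>exp (- 2 \<pi> \<i> k \<bullet> x)\<close> on which distributions are evaluated, so \<open>coef \<phi> k\<close> is the classical
  Fourier coefficient of \<open>\<phi>\<close> at \<open>- k\<close>.
\<close>

definition coef :: "torus_fun \<Rightarrow> int \<times> int \<Rightarrow> complex" where
  "coef \<phi> k = integral unit_square (\<lambda>x. \<phi> x * character (- k) x)"

lemma differentiable_slice1:
  fixes \<psi> :: torus_fun
  assumes "\<And>x. \<psi> differentiable (at x)"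
  shows "((\<lambda>t. \<psi> (t, y)) has_vector_derivative partial1 \<psi> (t, y)) (at t within S)"
proof -
  have "((\<lambda>t. (t, y)) has_vector_derivative (1, 0)) (at t within S)"
    by (auto intro!: derivative_eq_intros)
  moreover have "(\<psi> has_derivative frechet_derivative \<psi> (at (t, y))) (at (t, y) within (\<lambda>t. (t, y)) ` S)"
    using assms by (metis frechet_derivative_works has_derivative_at_withinI)
  ultimately show ?thesis
    using vector_derivative_diff_chain_within[of "\<lambda>t. (t, y)" _ t S \<psi>] 
    by (simp add: partial1_def o_def)
qed

lemma differentiable_slice2:
  fixes \<psi> :: torus_fun
  assumes "\<And>x. \<psi> differentiable (at x)"
  shows "((\<lambda>t. \<psi> (y, t)) has_vector_derivative partial2 \<psi> (y, t)) (at t within S)"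
proof -
  have "((\<lambda>t. (y, t)) has_vector_derivative (0, 1)) (at t within S)"
    by (auto intro!: derivative_eq_intros)
  moreover have "(\<psi> has_derivative frechet_derivative \<psi> (at (y, t))) (at (y, t) within (\<lambda>t. (y, t)) ` S)"
    using assms by (metis frechet_derivative_works has_derivative_at_withinI)
  ultimately show ?thesis
    using vector_derivative_diff_chain_within[of "\<lambda>t. (y, t)" _ t S \<psi>] 
    by (simp add: partial2_def o_def)
qed

text \<open>
  The fundamental theorem of calculus on each vertical segment: the boundary values cancel by
  periodicity.
\<close>

lemma integral_partial2_zero:
  assumes "periodic \<psi>" "\<And>x. \<psi> differentiable (at x)" "continuous_on UNIV (partial2 \<psi>)"
  shows "integral unit_square (partial2 \<psi>) = 0"
proof -
  have "\<psi> (x, 1) = \<psi> (x, 0)" for x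
    using assms(1)[unfolded periodic_def, rule_format, of "(x, 0)" "(0, 1)"] by (simp add: emb_def)
  then have "integral (cbox 0 1) (\<lambda>y. partial2 \<psi> (x, y)) = 0" for x
    using fundamental_theorem_of_calculus[of 0 1 "\<lambda>y. \<psi> (x, y)", OF _ differentiable_slice2[OF assms(2)]]
    by (simp add: integral_unique)
  then show ?thesis
    using assms(3) by (subst integral_prod_continuous) (auto elim: continuous_on_subset)
qed

text \<open>
  Same argument on horizontal segments, after exchanging the order of integration.
\<close>

lemma integral_partial1_zero:
  assumes "periodic \<psi>" "\<And>x. \<psi> differentiable (at x)" "continuous_on UNIV (partial1 \<psi>)"
  shows "integral unit_square (partial1 \<psi>) = 0"
proof -
  have "\<psi> (1, y) = \<psi> (0, y)" for y
    using assms(1)[unfolded periodic_def, rule_format, of "(0, y)" "(1, 0)"] by (simp add: emb_def)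
  then have *: "integral (cbox 0 1) (\<lambda>x. partial1 \<psi> (x, y)) = 0" for y
    using fundamental_theorem_of_calculus[of 0 1 "\<lambda>x. \<psi> (x, y)", OF _ differentiable_slice1[OF assms(2)]]
    by (simp add: integral_unique)
  have c: "continuous_on unit_square (partial1 \<psi>)"
    using assms(3) by (rule continuous_on_subset) simp
  have "integral unit_square (partial1 \<psi>)
      = integral (cbox 0 1) (\<lambda>x. integral (cbox 0 1) (\<lambda>y. partial1 \<psi> (x, y)))"
    using c by (rule integral_prod_continuous)
  also have "\<dots> = integral (cbox 0 1) (\<lambda>y. integral (cbox 0 1) (\<lambda>x. partial1 \<psi> (x, y)))"
    using c by (intro integral_swap_continuous) simp
  finally show ?thesis by (simp only: * integral_0)
qed

lemma integrable_on_unit_square: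
  fixes \<phi> :: torus_fun
  shows "continuous_on UNIV \<phi> \<Longrightarrow> \<phi> integrable_on unit_square"
  by (intro integrable_continuous) (auto elim: continuous_on_subset)

lemma integrable_coef:
  "continuous_on UNIV \<phi> \<Longrightarrow> (\<lambda>x. \<phi> x * character k x) integrable_on unit_square"
  by (intro integrable_on_unit_square continuous_intros)

lemma integral_norm_le_sup:
  fixes \<phi> :: torus_fun
  assumes "continuous_on UNIV \<phi>" "\<And>x. cmod (\<phi> x) \<le> B"
  shows "cmod (integral unit_square \<phi>) \<le> B"
proof -
  have "0 \<le> B" using assms(2)[of 0] norm_ge_zero order_trans by blast
  then show ?thesis
    using has_integral_bound[OF _ integrable_integral[OF integrable_on_unit_square[OF assms(1)]], of B] assms(2)
    by (simp add: content_Pair)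
qed

lemma norm_coef_le:
  assumes "continuous_on UNIV \<phi>" "\<And>x. cmod (\<phi> x) \<le> B"
  shows "cmod (coef \<phi> k) \<le> B"
  unfolding coef_def using assms
  by (intro integral_norm_le_sup continuous_intros) (simp_all add: norm_mult)

lemma freq1_minus [simp]: "freq1 (- k) = - freq1 k"
  and freq2_minus [simp]: "freq2 (- k) = - freq2 k"
  by (simp_all add: freq1_def freq2_def)

text \<open>
  Integration by parts: the integral of the derivative of \<open>\<phi> x * character (- k) x\<close> vanishes.
\<close>

lemma coef_partial1:
  assumes \<phi>: "\<phi> \<in> test_fun"
  shows "coef (partial1 \<phi>) k = freq1 k * coef \<phi> k"
proof -
  have cont: "continuous_on UNIV \<phi>" "continuous_on UNIV (partial1 \<phi>)"
    using \<phi> partial1_test_fun test_fun_continuous by blast+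
  have d: "\<And>x. (\<lambda>x. \<phi> x * character (- k) x) differentiable (at x)"
    using test_fun_differentiable[OF \<phi>] character_differentiable by (intro differentiable_mult)
  have eq: "partial1 (\<lambda>x. \<phi> x * character (- k) x)
      = (\<lambda>x. partial1 \<phi> x * character (- k) x - freq1 k * (\<phi> x * character (- k) x))"
    using test_fun_differentiable[OF \<phi>] character_differentiable
    by (subst partial1_mult) (auto simp: partial1_character algebra_simps)
  have "integral unit_square (partial1 (\<lambda>x. \<phi> x * character (- k) x)) = 0"
  proof (rule integral_partial1_zero)
    show "periodic (\<lambda>x. \<phi> x * character (- k) x)"
      using \<phi> periodic_character by (simp add: periodic_def test_fun_def)
    show "continuous_on UNIV (partial1 (\<lambda>x. \<phi> x * character (- k) x))"
      unfolding eq by (intro continuous_intros cont)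
  qed (rule d)
  moreover have "integral unit_square (partial1 (\<lambda>x. \<phi> x * character (- k) x))
      = coef (partial1 \<phi>) k - freq1 k * coef \<phi> k"
    unfolding eq coef_def using integrable_coef[OF cont(1), of "- k"] integrable_coef[OF cont(2), of "- k"]
    by (subst integral_diff) (auto intro: integrable_on_mult_right)
  ultimately show ?thesis by simp
qed

lemma coef_partial2:
  assumes \<phi>: "\<phi> \<in> test_fun"
  shows "coef (partial2 \<phi>) k = freq2 k * coef \<phi> k"
proof -
  have cont: "continuous_on UNIV \<phi>" "continuous_on UNIV (partial2 \<phi>)"
    using \<phi> partial2_test_fun test_fun_continuous by blast+
  have d: "\<And>x. (\<lambda>x. \<phi> x * character (- k) x) differentiable (at x)"
    using test_fun_differentiable[OF \<phi>] character_differentiable by (intro differentiable_mult)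
  have eq: "partial2 (\<lambda>x. \<phi> x * character (- k) x)
      = (\<lambda>x. partial2 \<phi> x * character (- k) x - freq2 k * (\<phi> x * character (- k) x))"
    using test_fun_differentiable[OF \<phi>] character_differentiable
    by (subst partial2_mult) (auto simp: partial2_character algebra_simps)
  have "integral unit_square (partial2 (\<lambda>x. \<phi> x * character (- k) x)) = 0"
  proof (rule integral_partial2_zero)
    show "periodic (\<lambda>x. \<phi> x * character (- k) x)"
      using \<phi> periodic_character by (simp add: periodic_def test_fun_def)
    show "continuous_on UNIV (partial2 (\<lambda>x. \<phi> x * character (- k) x))"
      unfolding eq by (intro continuous_intros cont)
  qed (rule d)
  moreover have "integral unit_square (partial2 (\<lambda>x. \<phi> x * character (- k) x))
      = coef (partial2 \<phi>) k - freq2 k * coef \<phi> k"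
    unfolding eq coef_def using integrable_coef[OF cont(1), of "- k"] integrable_coef[OF cont(2), of "- k"]
    by (subst integral_diff) (auto intro: integrable_on_mult_right)
  ultimately show ?thesis by simp
qed

lemma coef_deriv_ab:
  assumes "\<phi> \<in> test_fun"
  shows "coef (deriv_ab a b \<phi>) k = freq1 k ^ a * freq2 k ^ b * coef \<phi> k"
proof (induction a)
  case 0
  show ?case
  proof (induction b)
    case (Suc b)
    then show ?case
      using coef_partial2[OF deriv_ab_test_fun[OF assms, of 0 b]] by simp
  qed simp
next
  case (Suc a)
  then show ?case
    using coef_partial1[OF deriv_ab_test_fun[OF assms, of a b]] by simp
qed

lemma freq_eq_0_iff: "freq1 k = 0 \<and> freq2 k = 0 \<longleftrightarrow> k = 0"
  by (simp add: freq1_def freq2_def prod_eq_iff)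

text \<open>
  For \<open>j \<noteq> k\<close> the product is a nonconstant character; the integral of one of its partial
  derivatives, a nonzero multiple of the character, vanishes.
\<close>

lemma coef_character: "coef (character j) k = (if j = k then 1 else 0)"
proof -
  have eq: "coef (character j) k = integral unit_square (character (j - k))"
    by (simp add: coef_def character_add[of j "- k", symmetric])
  show ?thesis
  proof (cases "j = k")
    case True
    then have "character (j - k) = (\<lambda>x. 1)" by (auto simp: fun_eq_iff)
    with True eq show ?thesis by (simp add: content_Pair)
  next
    case False
    have "freq1 (j - k) * integral unit_square (character (j - k)) = 0"
      using integral_partial1_zero[OF periodic_character character_differentiable, of "j - k"]
        continuous_on_mult_left[OF continuous_on_character]
      by (simp add: partial1_character)
    moreover have "freq2 (j - k) * integral unit_square (character (j - k)) = 0"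
      using integral_partial2_zero[OF periodic_character character_differentiable, of "j - k"]
        continuous_on_mult_left[OF continuous_on_character]
      by (simp add: partial2_character)
    ultimately show ?thesis
      using False eq freq_eq_0_iff[of "j - k"] by auto
  qed
qed

lemma coef_add:
  assumes "continuous_on UNIV \<phi>" "continuous_on UNIV \<psi>"
  shows "coef (\<lambda>x. \<phi> x + \<psi> x) k = coef \<phi> k + coef \<psi> k"
  using integral_add[OF integrable_coef[OF assms(1)] integrable_coef[OF assms(2)]]
  by (simp add: coef_def distrib_right)

lemma coef_cmult: "coef (\<lambda>x. c * \<phi> x) k = c * coef \<phi> k"
  by (simp add: coef_def mult.assoc)

lemma periodic_bounded:
  assumes "periodic \<phi>" "continuous_on UNIV \<phi>"
  obtains B where "\<And>x. cmod (\<phi> x) \<le> B"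
proof -
  have "bounded (\<phi> ` unit_square)"
    by (intro compact_imp_bounded compact_continuous_image continuous_on_subset[OF assms(2)]) auto
  then obtain B where B: "\<And>x. x \<in> unit_square \<Longrightarrow> cmod (\<phi> x) \<le> B"
    by (auto simp: bounded_iff)
  have "cmod (\<phi> x) \<le> B" for x
  proof -
    let ?k = "(- \<lfloor>fst x\<rfloor>, - \<lfloor>snd x\<rfloor>)"
    have "x + emb ?k \<in> unit_square"
      by (cases x) (simp add: emb_def; linarith)
    from B[OF this] show ?thesis using assms(1) by (simp add: periodic_def)
  qed
  then show ?thesis by (rule that)
qed

text \<open>
  Periodicity makes every derivative of a test function bounded, so that the suprema in
  \<^const>\<open>C_norm\<close> are genuine.
\<close>

lemma deriv_ab_le_C_norm:
  assumes "\<phi> \<in> test_fun" "a + b \<le> N"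
  shows "cmod (deriv_ab a b \<phi> x) \<le> C_norm N \<phi>"
proof -
  have bdd: "bdd_above (range (\<lambda>x. cmod (deriv_ab i j \<phi> x)))" for i j
  proof -
    have t: "deriv_ab i j \<phi> \<in> test_fun" by (rule deriv_ab_test_fun[OF assms(1)])
    obtain B where "\<And>x. cmod (deriv_ab i j \<phi> x) \<le> B"
      using periodic_bounded[OF _ test_fun_continuous[OF t]] t by (auto simp: test_fun_def)
    then show ?thesis by (intro bdd_aboveI2)
  qed
  have nn: "0 \<le> (SUP x. cmod (deriv_ab i j \<phi> x))" for i j
    by (rule cSUP_upper2[OF bdd]) auto
  have fin: "finite {(i, j). i + j \<le> N}"
    by (rule finite_subset[of _ "{..N} \<times> {..N}"]) auto
  have "cmod (deriv_ab a b \<phi> x) \<le> (SUP x. cmod (deriv_ab a b \<phi> x))"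
    by (rule cSUP_upper[OF _ bdd]) auto
  also have "\<dots> \<le> C_norm N \<phi>"
    unfolding C_norm_def
    using member_le_sum[of "(a, b)" "{(i, j). i + j \<le> N}" "\<lambda>(i, j). SUP x. cmod (deriv_ab i j \<phi> x)"]
      assms(2) nn fin by (auto split: prod.splits)
  finally show ?thesis .
qed

text \<open>
  An \<open>\<ell>\<^sup>1\<close> version of \<^const>\<open>jbracket\<close>; it suits integer powers and
  dominates \<open>1 + |k\<^sub>1|\<close> and \<open>1 + |k\<^sub>2|\<close> separately.
\<close>

definition weight :: "int \<times> int \<Rightarrow> real" where
  "weight k = 1 + \<bar>of_int (fst k)\<bar> + \<bar>of_int (snd k)\<bar>"

lemma weight_ge_1: "1 \<le> weight k"
  by (simp add: weight_def)

text \<open>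
  One of \<open>1\<close>, \<open>|k\<^sub>1|\<close>, \<open>|k\<^sub>2|\<close> is at least a third of the weight. Multiplying a coefficient by the
  \<open>N\<close>-th power of \<open>k\<^sub>1\<close> or \<open>k\<^sub>2\<close> amounts, up to powers of \<open>2 \<pi>\<close>, to taking \<open>N\<close> derivatives of
  \<open>\<phi>\<close>, which are bounded by \<open>C_norm N \<phi>\<close>.
\<close>

lemma coef_decay:
  assumes "\<phi> \<in> test_fun"
  shows "weight k ^ N * cmod (coef \<phi> k) \<le> 3 ^ N * C_norm N \<phi>"
proof -
  have le: "cmod (freq1 k ^ a * freq2 k ^ b) * cmod (coef \<phi> k) \<le> C_norm N \<phi>" if "a + b \<le> N" for a b
    using norm_coef_le[OF test_fun_continuous[OF deriv_ab_test_fun[OF assms, of a b]]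
        deriv_ab_le_C_norm[OF assms that], of k]
    by (simp add: coef_deriv_ab[OF assms] norm_mult)
  have n1: "\<bar>of_int (fst k)\<bar> \<le> cmod (freq1 k)" and n2: "\<bar>of_int (snd k)\<bar> \<le> cmod (freq2 k)"
    using mult_right_mono[of 1 "2 * pi" "\<bar>of_int (fst k)\<bar>"]
      mult_right_mono[of 1 "2 * pi" "\<bar>of_int (snd k)\<bar>"] pi_ge_two
    by (simp_all add: freq1_def freq2_def norm_mult)
  consider "weight k \<le> 3" | "weight k \<le> 3 * cmod (freq1 k)" | "weight k \<le> 3 * cmod (freq2 k)"
    using n1 n2 unfolding weight_def by linarith
  then show ?thesis
  proof cases
    case 1
    then have "weight k ^ N * cmod (coef \<phi> k) \<le> 3 ^ N * cmod (coef \<phi> k)"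
      using weight_ge_1[of k] by (intro mult_right_mono power_mono) auto
    with le[of 0 0] show ?thesis by (simp add: order_trans)
  next
    case 2
    then have "weight k ^ N * cmod (coef \<phi> k) \<le> (3 * cmod (freq1 k)) ^ N * cmod (coef \<phi> k)"
      using weight_ge_1[of k] by (intro mult_right_mono power_mono) auto
    with le[of N 0] show ?thesis
      by (simp add: norm_power power_mult_distrib mult.assoc order_trans)
  next
    case 3
    then have "weight k ^ N * cmod (coef \<phi> k) \<le> (3 * cmod (freq2 k)) ^ N * cmod (coef \<phi> k)"
      using weight_ge_1[of k] by (intro mult_right_mono power_mono) auto
    with le[of 0 N] show ?thesis
      by (simp add: norm_power power_mult_distrib mult.assoc order_trans)
  qed
qed

lemma summable_on_inverse_square_int: "(\<lambda>n::int. 1 / (1 + \<bar>of_int n\<bar>)\<^sup>2 :: real) summable_on UNIV"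
proof -
  have s: "(\<lambda>n::nat. 1 / (1 + real n)\<^sup>2) summable_on UNIV"
    using inverse_power_summable[of 2, where 'a=real]
    by (intro norm_summable_imp_summable_on)
      (simp add: summable_Suc_iff[of "\<lambda>n. 1 / real n ^ 2", symmetric] inverse_eq_divide add.commute)
  have "(\<lambda>n::int. 1 / (1 + \<bar>of_int n\<bar>)\<^sup>2 :: real) summable_on range int"
    using s by (subst summable_on_reindex) (auto simp: o_def)
  moreover have "(\<lambda>n::int. 1 / (1 + \<bar>of_int n\<bar>)\<^sup>2 :: real) summable_on range (\<lambda>n. - int n)"
    using s by (subst summable_on_reindex) (auto simp: o_def inj_on_def)
  moreover have "(UNIV :: int set) = range int \<union> range (\<lambda>n. - int n)"
    by (auto intro: int_cases2)
  ultimately show ?thesis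
    using summable_on_union by metis
qed

lemma summable_on_product_nonneg:
  fixes f :: "'a \<Rightarrow> real" and g :: "'b \<Rightarrow> real"
  assumes "f summable_on UNIV" "g summable_on UNIV" "\<And>x. 0 \<le> f x" "\<And>y. 0 \<le> g y"
  shows "(\<lambda>z. f (fst z) * g (snd z)) summable_on UNIV"
proof -
  have "(\<lambda>z. norm (f (fst z) * g (snd z))) summable_on (UNIV \<times> UNIV)"
    unfolding Infinite_Sum.abs_summable_on_Sigma_iff
    using assms by (auto simp: abs_mult infsum_cmult_right' infsum_nonneg
        intro!: summable_on_cmult_right summable_on_cmult_left)
  then show ?thesis using assms by (simp add: abs_mult)
qed

text \<open>
  The weight dominates each factor of \<open>(1 + |k\<^sub>1|) (1 + |k\<^sub>2|)\<close>, so the exponent 4 leaves a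
  product of two convergent sums over the integers.
\<close>

lemma summable_on_weight: "(\<lambda>k. 1 / weight k ^ 4) summable_on UNIV"
proof -
  let ?f = "\<lambda>n::int. 1 / (1 + \<bar>of_int n\<bar>)\<^sup>2 :: real"
  have s: "(\<lambda>k. ?f (fst k) * ?f (snd k)) summable_on UNIV"
    using summable_on_product_nonneg[OF summable_on_inverse_square_int summable_on_inverse_square_int]
    by simp
  show ?thesis
  proof (rule summable_on_comparison_test[OF s])
    fix k :: "int \<times> int"
    have "(1 + \<bar>of_int (fst k)\<bar> :: real)\<^sup>2 * (1 + \<bar>of_int (snd k)\<bar>)\<^sup>2 \<le> (weight k)\<^sup>2 * (weight k)\<^sup>2"
      unfolding weight_def by (intro mult_mono power_mono) auto
    also have "\<dots> = weight k ^ 4"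
      by (simp only: power2_eq_square power4_eq_xxxx mult.assoc)
    finally have "1 / weight k ^ 4 \<le> 1 / ((1 + \<bar>of_int (fst k)\<bar> :: real)\<^sup>2 * (1 + \<bar>of_int (snd k)\<bar>)\<^sup>2)"
      by (intro divide_left_mono mult_pos_pos zero_less_power) (auto simp: weight_def add_pos_nonneg)
    then show "1 / weight k ^ 4 \<le> ?f (fst k) * ?f (snd k)"
      by simp
    show "0 \<le> 1 / weight k ^ 4"
      using order_trans[OF zero_le_one weight_ge_1] by (intro divide_nonneg_nonneg zero_le_power) auto
  qed
qed


section \<open>Completeness of the characters\<close>

lemma cnj_character: "cnj (character k x) = character (- k) x"
  by (simp add: character_def emb_minus exp_cnj)

text \<open>
  Multiplication by a trigonometric polynomial turns a function with vanishing Fourier coefficients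
  into another one. The property is closed under sums and products and holds for characters, so it
  passes to all polynomials in the coordinates of the torus without an explicit expansion into
  characters.
\<close>

definition preserves_null_coef :: "torus_fun \<Rightarrow> bool" where
  "preserves_null_coef p \<longleftrightarrow> continuous_on UNIV p \<and>
     (\<forall>\<psi>. continuous_on UNIV \<psi> \<longrightarrow> (\<forall>k. coef \<psi> k = 0) \<longrightarrow> (\<forall>k. coef (\<lambda>x. \<psi> x * p x) k = 0))"

lemma preserves_null_coef_const: "preserves_null_coef (\<lambda>x. c)"
  unfolding preserves_null_coef_def by (simp add: mult.commute[of _ c] coef_cmult)

lemma preserves_null_coef_character: "preserves_null_coef (character j)"
proof -
  have "coef (\<lambda>x. \<psi> x * character j x) k = coef \<psi> (k - j)" for \<psi> k
    by (simp add: coef_def mult.assoc character_add[symmetric])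
  then show ?thesis
    unfolding preserves_null_coef_def by (auto intro: continuous_on_character)
qed

lemma preserves_null_coef_add:
  assumes "preserves_null_coef p" "preserves_null_coef q"
  shows "preserves_null_coef (\<lambda>x. p x + q x)"
  using assms unfolding preserves_null_coef_def
  by (auto simp: distrib_left coef_add continuous_on_mult intro!: continuous_intros)

lemma preserves_null_coef_mult:
  assumes "preserves_null_coef p" "preserves_null_coef q"
  shows "preserves_null_coef (\<lambda>x. p x * q x)"
  using assms unfolding preserves_null_coef_def
  by (auto simp: mult.assoc[symmetric] continuous_on_mult intro!: continuous_intros)

text \<open>
  The torus as a compact subset of \<open>\<complex> \<times> \<complex>\<close>, where polynomial approximation is available.
\<close>

definition torus_map :: "real \<times> real \<Rightarrow> complex \<times> complex" where
  "torus_map x = (character (1, 0) x, character (0, 1) x)"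

lemma preserves_null_coef_Re: "preserves_null_coef (\<lambda>x. complex_of_real (Re (character k x)))"
proof -
  have "(\<lambda>x. complex_of_real (Re (character k x)))
      = (\<lambda>x. (1 / 2) * (character k x + character (- k) x))"
    by (simp add: fun_eq_iff cnj_character[symmetric] complex_add_cnj)
  then show ?thesis
    by (simp only:) (intro preserves_null_coef_add preserves_null_coef_mult
        preserves_null_coef_const preserves_null_coef_character)
qed

lemma preserves_null_coef_Im: "preserves_null_coef (\<lambda>x. complex_of_real (Im (character k x)))"
proof -
  have "(\<lambda>x. complex_of_real (Im (character k x)))
      = (\<lambda>x. (- \<i> / 2) * (character k x + (- 1) * character (- k) x))"
    by (simp add: fun_eq_iff cnj_character[symmetric] complex_eq_iff)
  then show ?thesis
    by (simp only:) (intro preserves_null_coef_add preserves_null_coef_mult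
        preserves_null_coef_const preserves_null_coef_character)
qed

text \<open>
  The linear case is the only one with content: a real-linear form on \<open>\<complex> \<times> \<complex>\<close> is a combination
  of the real and imaginary parts of the two coordinates, which are sums of characters on the torus.
\<close>

lemma preserves_null_coef_real_polynomial:
  assumes "real_polynomial_function q"
  shows "preserves_null_coef (\<lambda>x. complex_of_real (q (torus_map x)))"
  using assms
proof induction
  case (linear f)
  have eq: "f z = Re (fst z) * f (1, 0) + Im (fst z) * f (\<i>, 0) + Re (snd z) * f (0, 1) + Im (snd z) * f (0, \<i>)" for z
  proof -
    have z: "z = Re (fst z) *\<^sub>R (1, 0) + Im (fst z) *\<^sub>R (\<i>, 0) + Re (snd z) *\<^sub>R (0, 1) + Im (snd z) *\<^sub>R (0, \<i>)"
      by (simp add: prod_eq_iff complex_eq_iff)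
    have l: "linear f" using linear by (rule bounded_linear.linear)
    show ?thesis
      by (subst z, simp only: linear_add[OF l] linear_scale[OF l] real_scaleR_def)
  qed
  show ?case
    by (subst eq, simp only: torus_map_def fst_conv snd_conv of_real_add of_real_mult)
      (intro preserves_null_coef_add preserves_null_coef_mult preserves_null_coef_const
        preserves_null_coef_Re preserves_null_coef_Im)
next
  case (const c)
  then show ?case by (rule preserves_null_coef_const)
next
  case (add f g)
  show ?case
    unfolding of_real_add by (intro preserves_null_coef_add add)
next
  case (mult f g)
  show ?case
    unfolding of_real_mult by (intro preserves_null_coef_mult mult)
qed

lemma preserves_null_coef_polynomial:
  fixes q :: "complex \<times> complex \<Rightarrow> complex"
  assumes "polynomial_function q"
  shows "preserves_null_coef (\<lambda>x. q (torus_map x))"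
proof -
  have "real_polynomial_function (\<lambda>z. Re (q z))" "real_polynomial_function (\<lambda>z. Im (q z))"
    using assms bounded_linear_Re bounded_linear_Im
    unfolding polynomial_function_def by (auto simp: o_def)
  then have "preserves_null_coef (\<lambda>x. complex_of_real (Re (q (torus_map x))) + \<i> * complex_of_real (Im (q (torus_map x))))"
    by (intro preserves_null_coef_add preserves_null_coef_mult preserves_null_coef_const
        preserves_null_coef_real_polynomial)
  then show ?thesis by (simp flip: complex_eq)
qed

lemma torus_map_eq_imp:
  assumes "torus_map x = torus_map y"
  obtains k where "y = x + emb k"
proof -
  have *: "\<exists>n. t = s + of_int n"
    if e: "exp (- 2 * complex_of_real pi * \<i> * complex_of_real s) = exp (- 2 * complex_of_real pi * \<i> * complex_of_real t)"
    for s t :: real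
  proof -
    obtain n :: int where n: "- 2 * complex_of_real pi * \<i> * complex_of_real s
        = - 2 * complex_of_real pi * \<i> * complex_of_real t + (of_int (2 * n) * pi) * \<i>"
      using e unfolding exp_eq by blast
    have "- 2 * pi * s = - 2 * pi * t + 2 * of_int n * pi"
      using arg_cong[OF n, of Im] by simp
    then have "pi * (t - s - of_int n) = 0"
      by (simp only: algebra_simps)
    then have "t - s - of_int n = 0"
      using pi_neq_zero by (simp only: mult_eq_0_iff) simp
    then show ?thesis by (intro exI[of _ n]) simp
  qed
  have "\<exists>m. fst y = fst x + of_int m" "\<exists>n. snd y = snd x + of_int n"
    using assms by (auto intro!: * simp: torus_map_def character_def emb_def inner_prod_def)
  then obtain m n where "fst y = fst x + of_int m" "snd y = snd x + of_int n" by blast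
  then show ?thesis by (intro that[of "(m, n)"]) (simp add: emb_def prod_eq_iff)
qed

lemma continuous_on_torus_map: "continuous_on S torus_map"
  unfolding torus_map_def by (intro continuous_intros)

text \<open>
  As a continuous surjection from a compact onto a Hausdorff space, \<^const>\<open>torus_map\<close> restricted to
  the unit square is a quotient map, and two points with the same image differ by a lattice vector.
\<close>

lemma periodic_factors_through_torus:
  assumes "periodic \<psi>" "continuous_on UNIV \<psi>"
  obtains f where "continuous_on (torus_map ` unit_square) f"
    "\<And>x. x \<in> unit_square \<Longrightarrow> f (torus_map x) = \<psi> x"
proof -
  have "quotient_map (top_of_set unit_square) (top_of_set (torus_map ` unit_square)) torus_map"
    by (intro continuous_imp_quotient_map)
      (auto simp: continuous_on_torus_map compact_space_subtopology Hausdorff_space_subtopology)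
  moreover have "continuous_map (top_of_set unit_square) euclidean \<psi>"
    using continuous_on_subset[OF assms(2)] by simp
  moreover have "\<psi> x = \<psi> y" if "torus_map x = torus_map y" for x y
    using torus_map_eq_imp[OF that] assms(1) unfolding periodic_def by metis
  ultimately obtain f where "continuous_map (top_of_set (torus_map ` unit_square)) euclidean f"
    "\<And>x. x \<in> topspace (top_of_set unit_square) \<Longrightarrow> f (torus_map x) = \<psi> x"
    by (rule quotient_map_lift_exists) auto
  then show ?thesis by (intro that[of f]) auto
qed

lemma periodic_eqI:
  assumes "periodic \<phi>" "periodic \<psi>" "\<And>x. x \<in> unit_square \<Longrightarrow> \<phi> x = \<psi> x"
  shows "\<phi> x = \<psi> x"
proof -
  let ?k = "(- \<lfloor>fst x\<rfloor>, - \<lfloor>snd x\<rfloor>)"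
  have "x + emb ?k \<in> unit_square"
    by (cases x) (simp add: emb_def; linarith)
  from assms(3)[OF this] show ?thesis using assms(1,2) by (simp add: periodic_def)
qed

text \<open>
  The conjugate of \<open>\<psi>\<close> is a uniform limit of trigonometric polynomials, and \<open>\<psi>\<close> is orthogonal to
  all of these. Hence \<open>\<integral> |\<psi>|\<^sup>2 = 0\<close>.
\<close>

lemma coef_eq_0_imp_eq_0:
  assumes "periodic \<psi>" "continuous_on UNIV \<psi>" "\<And>k. coef \<psi> k = 0"
  shows "\<psi> x = 0"
proof -
  obtain B0 where B0: "\<And>x. cmod (\<psi> x) \<le> B0"
    using periodic_bounded[OF assms(1,2)] by blast
  \<comment> \<open>Bounding by a positive number allows the division by \<open>B\<close> below.\<close>
  define B where "B = max 1 B0"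
  have B: "\<And>x. cmod (\<psi> x) \<le> B" "B > 0"
    using B0 by (auto simp: B_def le_max_iff_disj)
  have "periodic (\<lambda>x. cnj (\<psi> x))" "continuous_on UNIV (\<lambda>x. cnj (\<psi> x))"
    using assms(1,2) by (auto simp: periodic_def intro!: continuous_intros)
  then obtain f where f: "continuous_on (torus_map ` unit_square) f"
    "\<And>x. x \<in> unit_square \<Longrightarrow> f (torus_map x) = cnj (\<psi> x)"
    using periodic_factors_through_torus by blast
  have "cmod (integral unit_square (\<lambda>x. \<psi> x * cnj (\<psi> x))) \<le> e" if "e > 0" for e
  proof -
    have "compact (torus_map ` unit_square)"
      by (intro compact_continuous_image continuous_on_torus_map compact_cbox)
    then obtain q where q: "polynomial_function q"
      "\<forall>z \<in> torus_map ` unit_square. cmod (f z - q z) < e / B"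
      using Stone_Weierstrass_polynomial_function[OF _ f(1), of "e / B"] \<open>e > 0\<close> \<open>B > 0\<close>
      by (metis divide_pos_pos)
    have p: "continuous_on UNIV (\<lambda>x. q (torus_map x))" "coef (\<lambda>x. \<psi> x * q (torus_map x)) 0 = 0"
      using preserves_null_coef_polynomial[OF q(1)] assms(2,3)
      unfolding preserves_null_coef_def by blast+
    have "integral unit_square (\<lambda>x. \<psi> x * q (torus_map x)) = 0"
      using p(2) by (simp add: coef_def)
    then have "integral unit_square (\<lambda>x. \<psi> x * cnj (\<psi> x))
        = integral unit_square (\<lambda>x. \<psi> x * cnj (\<psi> x) - \<psi> x * q (torus_map x))"
      by (subst integral_diff) (auto intro!: integrable_on_unit_square continuous_intros assms(2) p(1))
    moreover have "((\<lambda>x. \<psi> x * cnj (\<psi> x) - \<psi> x * q (torus_map x)) has_integral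
        integral unit_square (\<lambda>x. \<psi> x * cnj (\<psi> x) - \<psi> x * q (torus_map x))) unit_square"
      by (intro integrable_integral integrable_on_unit_square continuous_intros assms(2) p(1))
    then have "cmod (integral unit_square (\<lambda>x. \<psi> x * cnj (\<psi> x) - \<psi> x * q (torus_map x)))
        \<le> (B * (e / B)) * measure lborel unit_square"
    proof (rule has_integral_bound[rotated])
      fix x assume x: "x \<in> unit_square"
      have "cmod (cnj (\<psi> x) - q (torus_map x)) \<le> e / B"
        using q(2) f(2)[OF x] x by force
      then show "cmod (\<psi> x * cnj (\<psi> x) - \<psi> x * q (torus_map x)) \<le> B * (e / B)"
        unfolding right_diff_distrib[symmetric] norm_mult using B
        by (intro mult_mono) auto
    qed (use \<open>e > 0\<close> \<open>B > 0\<close> in auto)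
    ultimately show ?thesis
      using \<open>B > 0\<close> by (simp add: content_Pair)
  qed
  then have "integral unit_square (\<lambda>x. \<psi> x * cnj (\<psi> x)) = 0"
    using field_le_epsilon[of "cmod (integral unit_square (\<lambda>x. \<psi> x * cnj (\<psi> x)))" 0] by auto
  moreover have "(\<lambda>x. \<psi> x * cnj (\<psi> x)) integrable_on unit_square"
    by (intro integrable_on_unit_square continuous_intros assms(2))
  ultimately have "((\<lambda>x. \<psi> x * cnj (\<psi> x)) has_integral 0) unit_square"
    unfolding has_integral_integrable_integral by blast
  from has_integral_linear[OF this bounded_linear_Re]
  have int0: "((\<lambda>x. (cmod (\<psi> x))\<^sup>2) has_integral 0) unit_square"
    by (simp only: o_def complex_norm_square[symmetric] Re_complex_of_real zero_complex.sel)
  have ne: "box (0, 0) (1, 1) \<noteq> ({} :: (real \<times> real) set)"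
    by (simp add: box_ne_empty Basis_prod_def)
  have cont: "continuous_on unit_square (\<lambda>x. (cmod (\<psi> x))\<^sup>2)"
    using assms(2) by (intro continuous_intros) (rule continuous_on_subset, auto)
  have "(cmod (\<psi> x))\<^sup>2 = 0" if "x \<in> unit_square" for x
    using has_integral_0_cbox_imp_0[OF cont _ int0 ne that] by simp
  then have "\<psi> x = 0" if "x \<in> unit_square" for x
    using that by (simp only: power2_eq_square mult_eq_0_iff norm_eq_zero disj_ac) blast
  then show ?thesis
    using periodic_eqI[OF assms(1), of "\<lambda>x. 0"] by (simp add: periodic_def)
qed


section \<open>Distributions and their Fourier coefficients\<close>

text \<open>
  Absolute convergence of the pairing between a sequence of polynomial growth and a test function.
  Four more powers of the weight than the growth exponent are spent on summability.
\<close>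

lemma summable_on_coef_growth:
  assumes \<phi>: "\<phi> \<in> test_fun" and c: "\<And>k. cmod (c k) \<le> K * weight k ^ M"
  shows "(\<lambda>k. cmod (c k * coef \<phi> k)) summable_on UNIV"
    and "(\<Sum>\<^sub>\<infinity>k. cmod (c k * coef \<phi> k))
      \<le> K * 3 ^ (M + 4) * (\<Sum>\<^sub>\<infinity>k. 1 / weight k ^ 4) * C_norm (M + 4) \<phi>"
proof -
  have K: "0 \<le> K"
    using c[of 0] norm_ge_zero[of "c 0"] by (simp add: weight_def del: norm_ge_zero)
  have w: "weight k > 0" for k
    using weight_ge_1[of k] by linarith
  have le: "cmod (c k * coef \<phi> k) \<le> K * 3 ^ (M + 4) * C_norm (M + 4) \<phi> * (1 / weight k ^ 4)" for k
  proof -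
    have "weight k ^ 4 * cmod (c k * coef \<phi> k) = cmod (c k) * (weight k ^ 4 * cmod (coef \<phi> k))"
      by (simp only: norm_mult mult.left_commute)
    also have "\<dots> \<le> K * weight k ^ M * (weight k ^ 4 * cmod (coef \<phi> k))"
      using c[of k] w[of k] by (intro mult_right_mono) auto
    also have "\<dots> = K * (weight k ^ (M + 4) * cmod (coef \<phi> k))"
      by (simp only: power_add mult.assoc)
    also have "\<dots> \<le> K * (3 ^ (M + 4) * C_norm (M + 4) \<phi>)"
      using coef_decay[OF \<phi>] K by (intro mult_left_mono)
    finally have "cmod (c k * coef \<phi> k) \<le> K * (3 ^ (M + 4) * C_norm (M + 4) \<phi>) / weight k ^ 4"
      by (simp only: pos_le_divide_eq[OF zero_less_power[OF w]] mult.commute)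
    then show ?thesis by (simp only: mult.assoc times_divide_eq_right mult_1_right)
  qed
  have s: "(\<lambda>k. K * 3 ^ (M + 4) * C_norm (M + 4) \<phi> * (1 / weight k ^ 4)) summable_on UNIV"
    by (intro summable_on_cmult_right summable_on_weight)
  show *: "(\<lambda>k. cmod (c k * coef \<phi> k)) summable_on UNIV"
    by (rule summable_on_comparison_test[OF s le norm_ge_zero])
  show "(\<Sum>\<^sub>\<infinity>k. cmod (c k * coef \<phi> k))
      \<le> K * 3 ^ (M + 4) * (\<Sum>\<^sub>\<infinity>k. 1 / weight k ^ 4) * C_norm (M + 4) \<phi>"
    using infsum_mono[OF * s le] infsum_cmult_right'[of "K * 3 ^ (M + 4) * C_norm (M + 4) \<phi>" "\<lambda>k. 1 / weight k ^ 4" UNIV]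
    by (simp only: mult.assoc mult.commute mult.left_commute)
qed

abbreviation fourier_sum :: "torus_fun \<Rightarrow> (int \<times> int) set \<Rightarrow> torus_fun" where
  "fourier_sum \<phi> X \<equiv> (\<lambda>x. \<Sum>k\<in>X. coef \<phi> k * character k x)"

lemma fourier_sum_test_fun: "fourier_sum \<phi> X \<in> test_fun"
  by (intro test_fun_sum test_fun_cmult character_in_test_fun)

lemma coef_sum:
  assumes "\<And>j. j \<in> X \<Longrightarrow> continuous_on UNIV (f j)"
  shows "coef (\<lambda>x. \<Sum>j\<in>X. f j x) k = (\<Sum>j\<in>X. coef (f j) k)"
  using assms
proof (induction X rule: infinite_finite_induct)
  case (insert j X)
  then show ?case by (simp add: coef_add continuous_on_sum)
qed (simp_all add: coef_def)

lemma coef_fourier_sum: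
  assumes "finite X" "k \<in> X"
  shows "coef (fourier_sum \<phi> X) k = coef \<phi> k"
proof -
  have "coef (fourier_sum \<phi> X) k = (\<Sum>j\<in>X. if j = k then coef \<phi> j else 0)"
    by (subst coef_sum) (auto simp: coef_cmult coef_character intro!: continuous_intros sum.cong)
  then show ?thesis using assms by simp
qed

text \<open>
  The series converges uniformly to some continuous periodic function, whose coefficients agree with
  those of \<open>\<phi>\<close> because \<^const>\<open>coef\<close> is continuous in the supremum norm. By completeness the limit
  is \<open>\<phi>\<close>.
\<close>

lemma fourier_series_uniform_limit:
  assumes \<phi>: "\<phi> \<in> test_fun"
  shows "uniform_limit UNIV (fourier_sum \<phi>) \<phi> (finite_subsets_at_top UNIV)"
proof -
  define T where "T x = (\<Sum>\<^sub>\<infinity>k. coef \<phi> k * character k x)" for x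
  have lim: "uniform_limit UNIV (fourier_sum \<phi>) T (finite_subsets_at_top UNIV)"
    unfolding T_def
  proof (rule Weierstrass_m_test_general)
    show "(\<lambda>k. cmod (1 * coef \<phi> k)) summable_on UNIV"
      by (rule summable_on_coef_growth(1)[OF \<phi>, of "\<lambda>_. 1" 1 0]) simp
  qed (simp add: norm_mult)
  have contS: "continuous_on UNIV (fourier_sum \<phi> X)" for X
    using test_fun_continuous[OF fourier_sum_test_fun] .
  have cont: "continuous_on UNIV T"
    by (rule uniform_limit_theorem[OF _ lim]) (auto intro: contS)
  have cont_minus: "continuous_on UNIV (\<lambda>x. (- 1) * T x)"
    by (intro continuous_intros cont)
  have cont': "continuous_on UNIV \<phi>" using \<phi> by (rule test_fun_continuous)
  have per: "periodic T"
    using periodic_character by (simp add: periodic_def T_def)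
  have "coef \<phi> k = coef T k" for k
  proof -
    have "cmod (coef \<phi> k - coef T k) \<le> e" if "e > 0" for e
    proof -
      have "\<forall>\<^sub>F X in finite_subsets_at_top UNIV. \<forall>x\<in>UNIV. dist (fourier_sum \<phi> X x) (T x) < e"
        using uniform_limitD[OF lim \<open>e > 0\<close>] .
      moreover have "\<forall>\<^sub>F X in finite_subsets_at_top UNIV. finite X \<and> k \<in> X"
        unfolding eventually_finite_subsets_at_top by (intro exI[of _ "{k}"]) auto
      ultimately have "\<forall>\<^sub>F X in finite_subsets_at_top UNIV.
          (finite X \<and> k \<in> X) \<and> (\<forall>x. dist (fourier_sum \<phi> X x) (T x) < e)"
        by eventually_elim auto
      from eventually_happens'[OF finite_subsets_at_top_neq_bot this]
      obtain X where X: "finite X" "k \<in> X" "\<And>x. dist (fourier_sum \<phi> X x) (T x) < e"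
        by blast
      have "coef (\<lambda>x. fourier_sum \<phi> X x + (- 1) * T x) k = coef \<phi> k - coef T k"
        using coef_add[OF contS cont_minus] coef_cmult[of "- 1" T k] coef_fourier_sum[OF X(1,2)] by simp
      moreover have "cmod (coef (\<lambda>x. fourier_sum \<phi> X x + (- 1) * T x) k) \<le> e"
      proof (rule norm_coef_le[OF continuous_on_add[OF contS cont_minus]])
        show "cmod (fourier_sum \<phi> X x + (- 1) * T x) \<le> e" for x
          using X(3)[of x] by (simp add: dist_norm)
      qed
      ultimately show ?thesis by simp
    qed
    then show ?thesis
      using field_le_epsilon[of "cmod (coef \<phi> k - coef T k)" 0] by auto
  qed
  then have "coef (\<lambda>x. \<phi> x + (- 1) * T x) k = 0" for k
    using coef_add[OF cont' cont_minus] coef_cmult[of "- 1" T k] by simp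
  then have "\<phi> x + (- 1) * T x = 0" for x
    using per \<phi> continuous_on_add[OF cont' cont_minus]
    by (intro coef_eq_0_imp_eq_0[of "\<lambda>x. \<phi> x + (- 1) * T x"])
      (simp_all add: periodic_def test_fun_def)
  then have "T = \<phi>" by (simp add: fun_eq_iff)
  with lim show ?thesis by simp
qed

text \<open>
  Differentiation commutes with taking partial sums. Uniform convergence for the derivatives of
  \<open>\<phi>\<close>, which are test functions again, is therefore convergence of all derivatives of the partial
  sums.
\<close>

lemma deriv_ab_fourier_sum:
  assumes "\<phi> \<in> test_fun"
  shows "deriv_ab a b (fourier_sum \<phi> X) = fourier_sum (deriv_ab a b \<phi>) X"
  by (simp add: deriv_ab_sum test_fun_cmult deriv_ab_cmult deriv_ab_character
      coef_deriv_ab[OF assms] mult.assoc mult.left_commute)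

lemma C_norm_fourier_sum_tendsto:
  assumes \<phi>: "\<phi> \<in> test_fun"
  shows "((\<lambda>X. C_norm N (\<lambda>x. \<phi> x - fourier_sum \<phi> X x)) \<longlongrightarrow> 0) (finite_subsets_at_top UNIV)"
proof -
  have "((\<lambda>X. SUP x. cmod (deriv_ab a b (\<lambda>x. \<phi> x - fourier_sum \<phi> X x) x)) \<longlongrightarrow> 0) (finite_subsets_at_top UNIV)"
    for a b
  proof (rule tendstoI)
    fix e :: real assume "e > 0"
    let ?\<psi> = "deriv_ab a b \<phi>"
    have t: "?\<psi> \<in> test_fun" by (rule deriv_ab_test_fun[OF \<phi>])
    have eq: "deriv_ab a b (\<lambda>x. \<phi> x - fourier_sum \<phi> X x) = (\<lambda>x. ?\<psi> x - fourier_sum ?\<psi> X x)" for X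
      by (simp only: deriv_ab_diff[OF \<phi> fourier_sum_test_fun] deriv_ab_fourier_sum[OF \<phi>])
    have "\<forall>\<^sub>F X in finite_subsets_at_top UNIV. \<forall>x\<in>UNIV. dist (fourier_sum ?\<psi> X x) (?\<psi> x) < e / 2"
      using uniform_limitD[OF fourier_series_uniform_limit[OF t], of "e / 2"] \<open>e > 0\<close> by simp
    then show "\<forall>\<^sub>F X in finite_subsets_at_top UNIV.
        dist (SUP x. cmod (deriv_ab a b (\<lambda>x. \<phi> x - fourier_sum \<phi> X x) x)) 0 < e"
    proof eventually_elim
      case (elim X)
      then have le: "cmod (?\<psi> x - fourier_sum ?\<psi> X x) \<le> e / 2" for x
        by (simp add: dist_norm norm_minus_commute less_imp_le)
      have "(SUP x. cmod (?\<psi> x - fourier_sum ?\<psi> X x)) \<le> e / 2"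
        using le by (intro cSUP_least) auto
      moreover have "0 \<le> (SUP x. cmod (?\<psi> x - fourier_sum ?\<psi> X x))"
        using le by (intro cSUP_upper2[of _ _ undefined] bdd_aboveI2[of _ _ "e / 2"]) auto
      ultimately show ?case
        using \<open>e > 0\<close> unfolding eq by simp
    qed
  qed
  then show ?thesis
    unfolding C_norm_def by (intro tendsto_null_sum) auto
qed

lemma distribution_add:
  "u \<in> distributions \<Longrightarrow> \<phi> \<in> test_fun \<Longrightarrow> \<psi> \<in> test_fun \<Longrightarrow> u (\<lambda>x. \<phi> x + \<psi> x) = u \<phi> + u \<psi>"
  by (simp add: distributions_def)

lemma distribution_cmult:
  "u \<in> distributions \<Longrightarrow> \<phi> \<in> test_fun \<Longrightarrow> u (\<lambda>x. c * \<phi> x) = c * u \<phi>"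
  by (simp add: distributions_def)

lemma distribution_diff:
  "u \<in> distributions \<Longrightarrow> \<phi> \<in> test_fun \<Longrightarrow> \<psi> \<in> test_fun \<Longrightarrow> u (\<lambda>x. \<phi> x - \<psi> x) = u \<phi> - u \<psi>"
  using distribution_add[of u \<phi> "\<lambda>x. (- 1) * \<psi> x"] distribution_cmult[of u \<psi> "- 1"]
    test_fun_cmult[of \<psi> "- 1"] by simp

lemma distribution_zero: "u \<in> distributions \<Longrightarrow> u (\<lambda>x. 0) = 0"
  using distribution_cmult[of u "\<lambda>x. 0" 0] test_fun_zero by simp

lemma distribution_sum:
  assumes "u \<in> distributions" "\<And>k. k \<in> X \<Longrightarrow> \<phi> k \<in> test_fun"
  shows "u (\<lambda>x. \<Sum>k\<in>X. \<phi> k x) = (\<Sum>k\<in>X. u (\<phi> k))"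
  using assms(2)
proof (induction X rule: infinite_finite_induct)
  case (insert k X)
  then show ?case
    using distribution_add[OF assms(1), of "\<phi> k" "\<lambda>x. \<Sum>k\<in>X. \<phi> k x"] test_fun_sum[of X \<phi>]
    by simp
qed (simp_all add: distribution_zero assms(1))

text \<open>
  A distribution is continuous for some \<^const>\<open>C_norm\<close>, in which the Fourier series of \<open>\<phi>\<close>
  converges.
\<close>

lemma distribution_fourier_series:
  assumes u: "u \<in> distributions" and \<phi>: "\<phi> \<in> test_fun"
  shows "((\<lambda>k. coef \<phi> k * fourier u k) has_sum u \<phi>) UNIV"
proof -
  obtain N C where C: "\<And>\<psi>. \<psi> \<in> test_fun \<Longrightarrow> cmod (u \<psi>) \<le> C * C_norm N \<psi>"
    using u unfolding distributions_def by blast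
  have "u (fourier_sum \<phi> X) = (\<Sum>k\<in>X. coef \<phi> k * fourier u k)" for X
    using distribution_sum[OF u, of X "\<lambda>k x. coef \<phi> k * character k x"]
    by (simp add: test_fun_cmult distribution_cmult[OF u] fourier_eq_character)
  then have le: "cmod ((\<Sum>k\<in>X. coef \<phi> k * fourier u k) - u \<phi>)
      \<le> C * C_norm N (\<lambda>x. \<phi> x - fourier_sum \<phi> X x)" for X
    using C[OF test_fun_diff[OF \<phi> fourier_sum_test_fun[of \<phi> X]]]
    by (simp add: distribution_diff[OF u \<phi> fourier_sum_test_fun] norm_minus_commute)
  have "((\<lambda>X. C * C_norm N (\<lambda>x. \<phi> x - fourier_sum \<phi> X x)) \<longlongrightarrow> 0) (finite_subsets_at_top UNIV)"
    using tendsto_mult_left[OF C_norm_fourier_sum_tendsto[OF \<phi>], of C N] by simp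
  then show ?thesis
    unfolding has_sum_def
    by (subst LIM_zero_iff[symmetric], rule Lim_null_comparison[rotated]) (simp add: le)
qed

lemma distribution_eqI:
  assumes "u \<in> distributions" "v \<in> distributions" "\<And>k. fourier u k = fourier v k"
  shows "u = v"
proof
  fix \<phi>
  show "u \<phi> = v \<phi>"
  proof (cases "\<phi> \<in> test_fun")
    case True
    then show ?thesis
      using distribution_fourier_series[OF assms(1) True] distribution_fourier_series[OF assms(2) True]
      by (simp add: assms(3) has_sum_unique)
  next
    case False
    then show ?thesis using assms(1,2) by (simp add: distributions_def)
  qed
qed

text \<open>
  The distribution is the pairing of \<open>c\<close> with the coefficients of a test function; by orthogonality
  its value on \<open>character k\<close> is \<open>c k\<close>.
\<close>

lemma distribution_with_fourier:
  assumes c: "\<And>k. cmod (c k) \<le> K * weight k ^ M"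
  obtains h where "h \<in> distributions" "\<And>k. fourier h k = c k"
proof
  define h where "h \<phi> = (if \<phi> \<in> test_fun then \<Sum>\<^sub>\<infinity>k. c k * coef \<phi> k else 0)" for \<phi>
  have sum: "(\<lambda>k. c k * coef \<phi> k) summable_on UNIV" if "\<phi> \<in> test_fun" for \<phi>
    using summable_on_coef_growth(1)[OF that c] by (rule abs_summable_summable)
  show "h \<in> distributions"
    unfolding distributions_def
  proof (intro CollectI conjI ballI allI impI)
    fix \<phi> \<psi> assume t: "\<phi> \<in> test_fun" "\<psi> \<in> test_fun"
    show "h (\<lambda>x. \<phi> x + \<psi> x) = h \<phi> + h \<psi>"
      using infsum_add[OF sum[OF t(1)] sum[OF t(2)]] t
      by (simp add: h_def test_fun_add coef_add test_fun_continuous distrib_left)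
  next
    fix \<phi> a assume t: "\<phi> \<in> test_fun"
    show "h (\<lambda>x. a * \<phi> x) = a * h \<phi>"
      using t infsum_cmult_right'[of a "\<lambda>k. c k * coef \<phi> k" UNIV]
      by (simp add: h_def test_fun_cmult coef_cmult mult.left_commute)
  next
    have "cmod (h \<phi>) \<le> K * 3 ^ (M + 4) * (\<Sum>\<^sub>\<infinity>k. 1 / weight k ^ 4) * C_norm (M + 4) \<phi>"
      if t: "\<phi> \<in> test_fun" for \<phi>
      using order_trans[OF norm_infsum_bound[OF summable_on_coef_growth(1)[OF t c]]
          summable_on_coef_growth(2)[OF t c]] t
      by (simp add: h_def)
    then show "\<exists>N C. \<forall>\<phi>\<in>test_fun. cmod (h \<phi>) \<le> C * C_norm N \<phi>" by blast
  qed (simp add: h_def)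
  show "fourier h k = c k" for k
  proof -
    have "(\<Sum>\<^sub>\<infinity>j. c j * coef (character k) j) = (\<Sum>\<^sub>\<infinity>j\<in>{k}. c j * coef (character k) j)"
      by (rule infsum_cong_neutral) (auto simp: coef_character)
    then show ?thesis by (simp add: fourier_eq_character h_def coef_character)
  qed
qed


section \<open>The X-ray transform on the Fourier side\<close>

lemma integral_exp_full_period:
  assumes "c \<noteq> 0" "exp c = 1"
  shows "((\<lambda>t::real. exp (c * complex_of_real t)) has_integral 0) {0..1}"
proof -
  have "((\<lambda>t. exp (c * complex_of_real t) / c) has_vector_derivative exp (c * complex_of_real t))
      (at t within {0..1})" for t :: real
    using assms(1)
    by (auto intro!: derivative_eq_intros has_vector_derivative_real_field simp: field_simps)
  then have "((\<lambda>t::real. exp (c * complex_of_real t)) has_integral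
      exp (c * complex_of_real 1) / c - exp (c * complex_of_real 0) / c) {0..1}"
    by (intro fundamental_theorem_of_calculus) auto
  then show ?thesis using assms(2) by simp
qed

abbreviation perpendicular :: "int \<times> int \<Rightarrow> int \<times> int \<Rightarrow> bool" where
  "perpendicular k v \<equiv> fst k * fst v + snd k * snd v = 0"

text \<open>
  Along the segment from \<open>x\<close> to \<open>x + v\<close> the character is multiplied by an exponential with
  \<open>k \<bullet> v\<close> full periods, whose mean is zero unless \<open>k \<bullet> v = 0\<close>.
\<close>

lemma xray_fun_character:
  "xray_fun (character k) v = (if perpendicular k v then character k else (\<lambda>x. 0))"
proof
  fix x
  define n where "n = fst k * fst v + snd k * snd v"
  define c where "c = - 2 * complex_of_real pi * \<i> * of_int n"
  have "character k (t *\<^sub>R emb v) = exp (c * complex_of_real t)" for t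
    by (simp add: character_def c_def n_def emb_inner mult.assoc mult.left_commute[of "complex_of_real t"]
        mult.commute[of "complex_of_real t"])
  then have eq: "character k (x + t *\<^sub>R emb v) = character k x * exp (c * complex_of_real t)" for t
    by (simp add: character_translate)
  have "exp c = character k (emb v)"
    by (simp add: character_def c_def n_def emb_inner)
  then have "exp c = 1" by simp
  show "xray_fun (character k) v x = (if perpendicular k v then character k else (\<lambda>x. 0)) x"
  proof (cases "n = 0")
    case True
    then show ?thesis by (simp add: xray_fun_def eq n_def[symmetric] c_def)
  next
    case False
    then have "c \<noteq> 0" by (simp add: c_def)
    then have "integral {0..1} (\<lambda>t::real. exp (c * complex_of_real t)) = 0"
      using \<open>exp c = 1\<close> by (intro integral_unique integral_exp_full_period)
    with False show ?thesis by (simp add: xray_fun_def eq n_def[symmetric])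
  qed
qed

lemma fourier_xray:
  assumes "f \<in> distributions" "v \<in> Q"
  shows "fourier (xray Q f v) k = (if perpendicular k v then fourier f k else 0)"
  using assms by (simp add: fourier_eq_character xray_def xray_fun_character distribution_zero)

lemma perpendicular_collinear:
  fixes k v w :: "int \<times> int"
  assumes "k \<noteq> 0" "perpendicular k v" "perpendicular k w"
  shows "fst v * snd w = fst w * snd v"
proof -
  have "fst k * (fst v * snd w - fst w * snd v) = 0" "snd k * (fst v * snd w - fst w * snd v) = 0"
    using assms(2,3) by algebra+
  then show ?thesis using assms(1) by (auto simp: prod_eq_iff)
qed

text \<open>
  Collinear \<open>v\<close>, \<open>w\<close> have a common nonzero integer multiple, for instance the first coordinate of
  \<open>w\<close> times \<open>v\<close>; the uniqueness clause in \<^const>\<open>direction_set\<close> applies to this multiple.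
\<close>

lemma collinear_directions_eq:
  assumes Q: "direction_set Q" and "v \<in> Q" "w \<in> Q" and c: "fst v * snd w = fst w * snd v"
  shows "v = w"
proof -
  have eqI: "v = w" if "m * fst v = n * fst w" "m * snd v = n * snd w" "m \<noteq> 0" for m n
  proof -
    have "v \<noteq> 0" using Q \<open>v \<in> Q\<close> by (auto simp: direction_set_def)
    with \<open>m \<noteq> 0\<close> have "(m * fst v, m * snd v) \<noteq> 0" by (auto simp: prod_eq_iff)
    then have "\<exists>!q. q \<in> Q \<and> (\<exists>i. (m * fst v, m * snd v) = (i * fst q, i * snd q))"
      using Q unfolding direction_set_def by blast
    moreover have "\<exists>i. (m * fst v, m * snd v) = (i * fst v, i * snd v)" by blast
    moreover have "\<exists>i. (m * fst v, m * snd v) = (i * fst w, i * snd w)"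
      using that by auto
    ultimately show ?thesis using \<open>v \<in> Q\<close> \<open>w \<in> Q\<close> by blast
  qed
  have "w \<noteq> 0" using Q \<open>w \<in> Q\<close> by (auto simp: direction_set_def)
  then consider "fst w \<noteq> 0" | "snd w \<noteq> 0" by (auto simp: prod_eq_iff)
  then show ?thesis
  proof cases
    case 1
    then show ?thesis using c by (intro eqI[of "fst w" "fst v"]) auto
  next
    case 2
    then show ?thesis using c by (intro eqI[of "snd w" "snd v"]) (auto simp: mult.commute)
  qed
qed

text \<open>
  The vector \<open>(- k\<^sub>2, k\<^sub>1)\<close> is a multiple of some direction, which is then perpendicular to \<open>k\<close>.
  In the plane any other perpendicular direction is collinear with it.
\<close>

lemma ex1_perpendicular_direction:
  assumes Q: "direction_set Q" and "k \<noteq> 0"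
  shows "\<exists>!v. v \<in> Q \<and> perpendicular k v"
proof -
  have ne: "(- snd k, fst k) \<noteq> 0" using \<open>k \<noteq> 0\<close> by (auto simp: prod_eq_iff)
  then obtain q n where q: "q \<in> Q" "(- snd k, fst k) = (n * fst q, n * snd q)"
    using Q unfolding direction_set_def by blast
  have "n \<noteq> 0" using ne q(2) by (auto simp: prod_eq_iff)
  have "n * (fst k * fst q + snd k * snd q) = fst k * (n * fst q) + snd k * (n * snd q)"
    by (simp add: algebra_simps)
  also have "\<dots> = fst k * (- snd k) + snd k * fst k" using q(2) by simp
  finally have "perpendicular k q" using \<open>n \<noteq> 0\<close> by simp
  moreover have "v = q" if "v \<in> Q" "perpendicular k v" for v
    using collinear_directions_eq[OF Q that(1) q(1)]
      perpendicular_collinear[OF \<open>k \<noteq> 0\<close> that(2) \<open>perpendicular k q\<close>] .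
  ultimately show ?thesis using q(1) by blast
qed

definition perp_direction :: "(int \<times> int) set \<Rightarrow> int \<times> int \<Rightarrow> int \<times> int" where
  "perp_direction Q k = (THE v. v \<in> Q \<and> perpendicular k v)"

lemma perp_direction:
  assumes "direction_set Q" "k \<noteq> 0"
  shows "perp_direction Q k \<in> Q" "perpendicular k (perp_direction Q k)"
  using theI'[OF ex1_perpendicular_direction[OF assms]] by (simp_all add: perp_direction_def)

lemma perpendicular_iff_perp_direction:
  assumes "direction_set Q" "k \<noteq> 0" "v \<in> Q"
  shows "perpendicular k v \<longleftrightarrow> v = perp_direction Q k"
  using ex1_perpendicular_direction[OF assms(1,2)] perp_direction[OF assms(1,2)] assms(3) by auto

lemma direction_set_nonempty: "direction_set Q \<Longrightarrow> Q \<noteq> {}"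
  using perp_direction(1)[of Q "(1, 0)"] by (auto simp: prod_eq_iff)

section \<open>Sobolev spaces as weighted sequence spaces\<close>

lemma infsum_ennreal_finite_iff:
  fixes f :: "'a \<Rightarrow> real"
  assumes nn: "\<And>x. x \<in> A \<Longrightarrow> 0 \<le> f x"
  shows "(\<Sum>\<^sub>\<infinity>x\<in>A. ennreal (f x)) < \<infinity> \<longleftrightarrow> f summable_on A"
proof
  assume fin: "(\<Sum>\<^sub>\<infinity>x\<in>A. ennreal (f x)) < \<infinity>"
  show "f summable_on A"
  proof (rule nonneg_bdd_above_summable_on[OF nn])
    show "bdd_above (sum f ` {F. F \<subseteq> A \<and> finite F})"
    proof (rule bdd_aboveI2)
      fix F assume F: "F \<in> {F. F \<subseteq> A \<and> finite F}"
      then have "ennreal (sum f F) = (\<Sum>x\<in>F. ennreal (f x))"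
        using nn by (intro sum_ennreal[symmetric]) auto
      also have "\<dots> \<le> (\<Sum>\<^sub>\<infinity>x\<in>A. ennreal (f x))"
        using F by (subst nonneg_infsum_complete) (auto intro!: SUP_upper2[of F])
      finally show "sum f F \<le> enn2real (\<Sum>\<^sub>\<infinity>x\<in>A. ennreal (f x))"
        using fin by (metis enn2real_le ennreal_enn2real_if infinity_ennreal_def linorder_not_le ennreal_le_iff enn2real_nonneg less_irrefl)
    qed
  qed
next
  assume s: "f summable_on A"
  have "(\<Sum>x\<in>F. ennreal (f x)) \<le> ennreal (infsum f A)" if "F \<subseteq> A" "finite F" for F
  proof -
    have "(\<Sum>x\<in>F. ennreal (f x)) = ennreal (sum f F)"
      using nn that by (intro sum_ennreal) auto
    also have "\<dots> \<le> ennreal (infsum f A)"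
      using finite_sum_le_infsum[OF s that(2,1)] nn by (intro ennreal_leI) auto
    finally show ?thesis .
  qed
  then have "(\<Sum>\<^sub>\<infinity>x\<in>A. ennreal (f x)) \<le> ennreal (infsum f A)"
    by (subst nonneg_infsum_complete) (auto intro!: SUP_least)
  then show "(\<Sum>\<^sub>\<infinity>x\<in>A. ennreal (f x)) < \<infinity>"
    by (simp add: le_less_trans[of _ "ennreal (infsum f A)"])
qed

lemma infsum_ennreal_cmult:
  fixes f :: "'a \<Rightarrow> ennreal"
  shows "(\<Sum>\<^sub>\<infinity>x\<in>A. c * f x) = c * (\<Sum>\<^sub>\<infinity>x\<in>A. f x)"
proof -
  have "(\<Sum>\<^sub>\<infinity>x\<in>A. c * f x) = (SUP F\<in>{F. finite F \<and> F \<subseteq> A}. c * sum f F)"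
    by (subst nonneg_infsum_complete) (auto simp: sum_distrib_left)
  also have "\<dots> = c * (SUP F\<in>{F. finite F \<and> F \<subseteq> A}. sum f F)"
    by (rule SUP_mult_left_ennreal[symmetric])
  finally show ?thesis by (subst nonneg_infsum_complete) auto
qed

lemma infsum_ennreal_single_le:
  fixes f :: "'a \<Rightarrow> ennreal"
  assumes "a \<in> A"
  shows "f a \<le> (\<Sum>\<^sub>\<infinity>x\<in>A. f x)"
  using assms by (subst nonneg_infsum_complete) (auto intro!: SUP_upper2[of "{a}"])

lemma jbracket_ge_1: "1 \<le> jbracket k"
  by (simp add: jbracket_def)

lemma jbracket_zero [simp]: "jbracket 0 = 1"
  by (simp add: jbracket_def)

lemma jbracket_le_weight: "jbracket k \<le> weight k"
proof -
  have "1 + (a\<^sup>2 + b\<^sup>2) \<le> (1 + \<bar>a\<bar> + \<bar>b\<bar>)\<^sup>2" for a b :: real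
  proof -
    have "(1 + \<bar>a\<bar> + \<bar>b\<bar>)\<^sup>2 = 1 + (\<bar>a\<bar>\<^sup>2 + \<bar>b\<bar>\<^sup>2) + 2 * (\<bar>a\<bar> + \<bar>b\<bar> + \<bar>a\<bar> * \<bar>b\<bar>)"
      by (simp only: power2_eq_square) algebra
    then show ?thesis by simp
  qed
  then have "sqrt (1 + ((of_int (fst k))\<^sup>2 + (of_int (snd k))\<^sup>2)) \<le> weight k"
    unfolding weight_def by (intro real_le_lsqrt) auto
  then show ?thesis
    by (simp add: jbracket_def emb_def norm_Pair)
qed

lemma jbracket_powr_pos [simp]: "0 < jbracket k powr a"
  using jbracket_ge_1[of k] by simp

lemma sobolev_iff:
  "f \<in> sobolev s \<longleftrightarrow> f \<in> distributions \<and>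
     (\<lambda>k. jbracket k powr (2 * s) * (cmod (fourier f k))\<^sup>2) summable_on UNIV"
  unfolding sobolev_def sobolev_normsq_def
  using infsum_ennreal_finite_iff[of UNIV "\<lambda>k. jbracket k powr (2 * s) * (cmod (fourier f k))\<^sup>2"]
  by simp

text \<open>
  Each term of a convergent sum of nonnegative numbers is bounded by the sum, so the coefficients
  grow at most like \<open>\<langle>k\<rangle>\<^bsup>-s\<^esup>\<close> and belong to some distribution.
\<close>

lemma sobolev_with_fourier:
  assumes sum: "(\<lambda>k. jbracket k powr (2 * s) * (cmod (c k))\<^sup>2) summable_on UNIV"
  obtains h where "h \<in> sobolev s" "\<And>k. fourier h k = c k"
proof -
  define S where "S = (\<Sum>\<^sub>\<infinity>k. jbracket k powr (2 * s) * (cmod (c k))\<^sup>2)"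
  have "cmod (c k) \<le> sqrt S * weight k ^ nat \<lceil>\<bar>s\<bar>\<rceil>" for k
  proof -
    have "(jbracket k powr s * cmod (c k))\<^sup>2 = jbracket k powr (2 * s) * (cmod (c k))\<^sup>2"
      using powr_add[of "jbracket k" s s] by (simp add: power2_eq_square)
    also have "\<dots> \<le> S"
      unfolding S_def using finite_sum_le_infsum[OF sum, of "{k}"] by simp
    finally have "jbracket k powr s * cmod (c k) \<le> sqrt S"
      by (rule real_le_rsqrt)
    then have le: "cmod (c k) \<le> sqrt S * jbracket k powr (- s)"
      by (simp add: powr_minus divide_inverse[symmetric] pos_le_divide_eq[OF jbracket_powr_pos] mult.commute)
    have "S \<ge> 0" unfolding S_def by (intro infsum_nonneg) simp
    have "jbracket k powr (- s) \<le> jbracket k powr \<bar>s\<bar>"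
      using jbracket_ge_1[of k] by (intro powr_mono) auto
    also have "\<dots> \<le> weight k powr \<bar>s\<bar>"
      using jbracket_le_weight[of k] jbracket_ge_1[of k] by (intro powr_mono2) auto
    also have "\<dots> \<le> weight k powr (real (nat \<lceil>\<bar>s\<bar>\<rceil>))"
      using weight_ge_1[of k] by (intro powr_mono) linarith+
    also have "\<dots> = weight k ^ nat \<lceil>\<bar>s\<bar>\<rceil>"
      using weight_ge_1[of k] by (intro powr_realpow) linarith
    finally show ?thesis
      using le mult_left_mono[of "jbracket k powr (- s)" "weight k ^ nat \<lceil>\<bar>s\<bar>\<rceil>" "sqrt S"] \<open>S \<ge> 0\<close>
      by simp
  qed
  then obtain h where h: "h \<in> distributions" "\<And>k. fourier h k = c k"
    using distribution_with_fourier by blast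
  then have "h \<in> sobolev s" using sum by (simp add: sobolev_iff)
  with h(2) show ?thesis by (rule that[rotated])
qed

lemma sobolev_mono:
  assumes "s \<le> t"
  shows "sobolev t \<subseteq> sobolev s"
proof
  fix f assume f: "f \<in> sobolev t"
  have "(\<lambda>k. jbracket k powr (2 * s) * (cmod (fourier f k))\<^sup>2) summable_on UNIV"
  proof (rule summable_on_comparison_test)
    show "(\<lambda>k. jbracket k powr (2 * t) * (cmod (fourier f k))\<^sup>2) summable_on UNIV"
      using f by (simp add: sobolev_iff)
    show "jbracket k powr (2 * s) * (cmod (fourier f k))\<^sup>2 \<le> jbracket k powr (2 * t) * (cmod (fourier f k))\<^sup>2" for k
      using assms jbracket_ge_1[of k] by (intro mult_right_mono powr_mono) auto
  qed simp
  with f show "f \<in> sobolev s" by (simp add: sobolev_iff)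
qed


section \<open>Decoupling of the data term and the adjoint\<close>

text \<open>
  The part of the data that the X-ray transform can reach. At \<open>k = 0\<close> every direction is
  perpendicular, and the common mean takes the place of a coefficient in one direction.
\<close>

definition perp_coef :: "(int \<times> int) set \<Rightarrow> family \<Rightarrow> int \<times> int \<Rightarrow> complex" where
  "perp_coef Q g k = (if k = 0 then mean0 Q g else fourier (g (perp_direction Q k)) k)"

text \<open>
  The part of the data at pairs \<open>(k, v)\<close> where every X-ray transform vanishes.
\<close>

definition offperp_normsq :: "(int \<times> int) set \<Rightarrow> real \<Rightarrow> family \<Rightarrow> ennreal" where
  "offperp_normsq Q r g = (\<Sum>\<^sub>\<infinity>k\<in>UNIV - {0}. \<Sum>\<^sub>\<infinity>v\<in>Q - {perp_direction Q k}.
     ennreal (jbracket k powr (2 * r) * (cmod (fourier (g v) k))\<^sup>2))"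

lemma ennreal_summable_on: "f summable_on A" for f :: "'a \<Rightarrow> ennreal"
  by (rule nonneg_summable_on_complete) simp

lemma infsum_split_zero:
  fixes F :: "int \<times> int \<Rightarrow> 'a::{topological_comm_monoid_add, t2_space}"
  assumes "F summable_on (UNIV - {0})"
  shows "infsum F UNIV = F 0 + infsum F (UNIV - {0})"
  using infsum_insert[OF assms, of 0] by (simp add: insert_UNIV)

lemma sobolevQ_normsq_split:
  assumes Q: "direction_set Q"
  shows "sobolevQ_normsq Q r g =
    (\<Sum>\<^sub>\<infinity>k. ennreal (jbracket k powr (2 * r) * (cmod (perp_coef Q g k))\<^sup>2)) + offperp_normsq Q r g"
proof -
  have inner: "(\<Sum>\<^sub>\<infinity>v\<in>Q. ennreal (jbracket k powr (2 * r) * (cmod (fourier (g v) k))\<^sup>2)) =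
      ennreal (jbracket k powr (2 * r) * (cmod (perp_coef Q g k))\<^sup>2) +
      (\<Sum>\<^sub>\<infinity>v\<in>Q - {perp_direction Q k}. ennreal (jbracket k powr (2 * r) * (cmod (fourier (g v) k))\<^sup>2))"
    if "k \<in> UNIV - {0}" for k
  proof -
    have "k \<noteq> 0" using that by simp
    have "Q = insert (perp_direction Q k) (Q - {perp_direction Q k})"
      using perp_direction(1)[OF Q \<open>k \<noteq> 0\<close>] by blast
    then show ?thesis
      using \<open>k \<noteq> 0\<close> infsum_insert[of "\<lambda>v. ennreal (jbracket k powr (2 * r) * (cmod (fourier (g v) k))\<^sup>2)"
        "Q - {perp_direction Q k}" "perp_direction Q k", OF ennreal_summable_on]
      by (simp add: perp_coef_def insert_absorb perp_direction(1)[OF Q])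
  qed
  have "(\<Sum>\<^sub>\<infinity>k\<in>UNIV - {0}. \<Sum>\<^sub>\<infinity>v\<in>Q. ennreal (jbracket k powr (2 * r) * (cmod (fourier (g v) k))\<^sup>2)) =
      (\<Sum>\<^sub>\<infinity>k\<in>UNIV - {0}. ennreal (jbracket k powr (2 * r) * (cmod (perp_coef Q g k))\<^sup>2)) + offperp_normsq Q r g"
    unfolding offperp_normsq_def
    by (subst infsum_cong[OF inner], assumption, rule infsum_add[OF ennreal_summable_on ennreal_summable_on])
  then show ?thesis
    unfolding sobolevQ_normsq_def
    by (subst infsum_split_zero[OF ennreal_summable_on]) (simp add: perp_coef_def add.assoc)
qed

lemma mean0_eqI:
  assumes "direction_set Q" "\<And>v. v \<in> Q \<Longrightarrow> fourier (g v) 0 = c"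
  shows "mean0 Q g = c"
  unfolding mean0_def
  using direction_set_nonempty[OF assms(1)] assms(2) by (intro the_equality) auto

lemma fourier_eq_mean0:
  assumes "direction_set Q" "g \<in> sobolevQ Q r" "v \<in> Q"
  shows "fourier (g v) 0 = mean0 Q g"
proof -
  have "fourier (g w) 0 = fourier (g v) 0" if "w \<in> Q" for w
    using assms(2,3) that unfolding sobolevQ_def by blast
  from mean0_eqI[of Q g, OF assms(1) this] show ?thesis by simp
qed

lemma sobolevQ_perp_coef_summable:
  assumes "direction_set Q" "g \<in> sobolevQ Q r"
  shows "(\<lambda>k. jbracket k powr (2 * r) * (cmod (perp_coef Q g k))\<^sup>2) summable_on UNIV"
    and "offperp_normsq Q r g < \<infinity>"
proof -
  have "sobolevQ_normsq Q r g < \<infinity>"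
    using assms(2) by (simp add: sobolevQ_def)
  then have "(\<Sum>\<^sub>\<infinity>k. ennreal (jbracket k powr (2 * r) * (cmod (perp_coef Q g k))\<^sup>2)) < \<infinity>"
    and off: "offperp_normsq Q r g < \<infinity>"
    unfolding sobolevQ_normsq_split[OF assms(1)] by simp_all
  then show "(\<lambda>k. jbracket k powr (2 * r) * (cmod (perp_coef Q g k))\<^sup>2) summable_on UNIV"
    by (subst (asm) infsum_ennreal_finite_iff) simp_all
  show "offperp_normsq Q r g < \<infinity>" by (rule off)
qed

lemma sobolevQ_normsq_xray_diff:
  assumes Q: "direction_set Q" and f: "f \<in> distributions" and g: "g \<in> sobolevQ Q r"
  shows "sobolevQ_normsq Q r (\<lambda>v \<phi>. xray Q f v \<phi> - g v \<phi>) =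
    (\<Sum>\<^sub>\<infinity>k. ennreal (jbracket k powr (2 * r) * (cmod (fourier f k - perp_coef Q g k))\<^sup>2)) + offperp_normsq Q r g"
proof -
  let ?d = "\<lambda>v \<phi>. xray Q f v \<phi> - g v \<phi>"
  have d: "fourier (?d v) k = (if perpendicular k v then fourier f k else 0) - fourier (g v) k"
    if "v \<in> Q" for v k
    using fourier_xray[OF f that, of k] by (simp add: fourier_def)
  have "mean0 Q ?d = fourier f 0 - mean0 Q g"
    using d fourier_eq_mean0[OF Q g] by (intro mean0_eqI[OF Q]) simp
  then have "perp_coef Q ?d k = fourier f k - perp_coef Q g k" for k
    using d[OF perp_direction(1)[OF Q], of k k] perp_direction(2)[OF Q, of k]
    by (simp add: perp_coef_def)
  moreover have "offperp_normsq Q r ?d = offperp_normsq Q r g"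
    unfolding offperp_normsq_def
  proof (intro infsum_cong)
    fix k v assume "k \<in> UNIV - {0 :: int \<times> int}" "v \<in> Q - {perp_direction Q k}"
    then have "\<not> perpendicular k v" "v \<in> Q"
      using perpendicular_iff_perp_direction[OF Q, of k v] by auto
    then show "ennreal (jbracket k powr (2 * r) * (cmod (fourier (?d v) k))\<^sup>2) =
        ennreal (jbracket k powr (2 * r) * (cmod (fourier (g v) k))\<^sup>2)"
      using d[of v k] by simp
  qed
  ultimately show ?thesis
    by (simp add: sobolevQ_normsq_split[OF Q])
qed

text \<open>
  The Cauchy-Schwarz inequality in its qualitative form, from \<open>2 |b c| \<le> |b|\<^sup>2 + |c|\<^sup>2\<close>.
\<close>

lemma summable_on_weighted_product:
  fixes b c :: "'a \<Rightarrow> complex"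
  assumes w: "\<And>k. 0 \<le> w k"
    and b: "(\<lambda>k. w k * (cmod (b k))\<^sup>2) summable_on A"
    and c: "(\<lambda>k. w k * (cmod (c k))\<^sup>2) summable_on A"
  shows "(\<lambda>k. complex_of_real (w k) * b k * cnj (c k)) summable_on A"
proof (rule abs_summable_summable, rule summable_on_comparison_test)
  show "(\<lambda>k. w k * (cmod (b k))\<^sup>2 + w k * (cmod (c k))\<^sup>2) summable_on A"
    using b c by (rule summable_on_add)
  fix k
  have "2 * (cmod (b k) * cmod (c k)) \<le> (cmod (b k))\<^sup>2 + (cmod (c k))\<^sup>2"
    using sum_squares_bound[of "cmod (b k)" "cmod (c k)"] by (simp add: mult.assoc)
  moreover have "0 \<le> cmod (b k) * cmod (c k)" by simp
  ultimately have "cmod (b k) * cmod (c k) \<le> (cmod (b k))\<^sup>2 + (cmod (c k))\<^sup>2" by linarith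
  from mult_left_mono[OF this w[of k]]
  show "cmod (complex_of_real (w k) * b k * cnj (c k)) \<le> w k * (cmod (b k))\<^sup>2 + w k * (cmod (c k))\<^sup>2"
    using w[of k] by (simp add: norm_mult distrib_left mult.assoc)
qed simp

lemma sobolevQ_inner_xray:
  assumes Q: "direction_set Q" and f: "f \<in> sobolev r" and g: "g \<in> sobolevQ Q r"
  shows "sobolevQ_inner Q r (xray Q f) g =
    (\<Sum>\<^sub>\<infinity>k. complex_of_real (jbracket k powr (2 * r)) * fourier f k * cnj (perp_coef Q g k))"
proof -
  have fd: "f \<in> distributions" using f by (simp add: sobolev_iff)
  have mean: "mean0 Q (xray Q f) = fourier f 0"
    using fourier_xray[OF fd] by (intro mean0_eqI[OF Q]) simp
  have inner: "(\<Sum>\<^sub>\<infinity>v\<in>Q. complex_of_real (jbracket k powr (2 * r)) * fourier (xray Q f v) k * cnj (fourier (g v) k))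
      = complex_of_real (jbracket k powr (2 * r)) * fourier f k * cnj (perp_coef Q g k)"
    if "k \<in> UNIV - {0}" for k
  proof -
    have "k \<noteq> 0" using that by simp
    note p = perp_direction[OF Q this]
    have "(\<Sum>\<^sub>\<infinity>v\<in>Q. complex_of_real (jbracket k powr (2 * r)) * fourier (xray Q f v) k * cnj (fourier (g v) k))
        = (\<Sum>\<^sub>\<infinity>v\<in>{perp_direction Q k}. complex_of_real (jbracket k powr (2 * r)) * fourier (xray Q f v) k * cnj (fourier (g v) k))"
    proof (rule infsum_cong_neutral)
      fix v assume "v \<in> Q - {perp_direction Q k}"
      then have "v \<in> Q" "\<not> perpendicular k v"
        using perpendicular_iff_perp_direction[OF Q \<open>k \<noteq> 0\<close>] by blast+
      then show "complex_of_real (jbracket k powr (2 * r)) * fourier (xray Q f v) k * cnj (fourier (g v) k) = 0"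
        by (simp only: fourier_xray[OF fd] if_False mult_zero_left mult_zero_right)
    qed (use p(1) in simp_all)
    then show ?thesis
      using \<open>k \<noteq> 0\<close> by (simp add: fourier_xray[OF fd p(1)] p(2) perp_coef_def)
  qed
  have summable: "(\<lambda>k. complex_of_real (jbracket k powr (2 * r)) * fourier f k * cnj (perp_coef Q g k)) summable_on (UNIV - {0})"
  proof (rule summable_on_subset)
    show "(\<lambda>k. complex_of_real (jbracket k powr (2 * r)) * fourier f k * cnj (perp_coef Q g k)) summable_on UNIV"
      using f by (intro summable_on_weighted_product sobolevQ_perp_coef_summable(1)[OF Q g])
        (simp_all add: sobolev_iff)
  qed simp
  have "sobolevQ_inner Q r (xray Q f) g = fourier f 0 * cnj (mean0 Q g) +
      (\<Sum>\<^sub>\<infinity>k\<in>UNIV - {0}. \<Sum>\<^sub>\<infinity>v\<in>Q.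
        complex_of_real (jbracket k powr (2 * r)) * fourier (xray Q f v) k * cnj (fourier (g v) k))"
    by (simp only: sobolevQ_inner_def mean)
  also have "\<dots> = fourier f 0 * cnj (mean0 Q g) +
      (\<Sum>\<^sub>\<infinity>k\<in>UNIV - {0}. complex_of_real (jbracket k powr (2 * r)) * fourier f k * cnj (perp_coef Q g k))"
    by (intro arg_cong2[where f = "(+)"] refl infsum_cong inner)
  also have "\<dots> = (\<Sum>\<^sub>\<infinity>k. complex_of_real (jbracket k powr (2 * r)) * fourier f k * cnj (perp_coef Q g k))"
    by (subst infsum_split_zero[OF summable]) (simp add: perp_coef_def)
  finally show ?thesis .
qed

text \<open>
  Both inner products reduce to the same weighted sequence pairing, so the distribution with
  coefficients \<open>perp_coef Q g\<close> is an adjoint. Testing with the distribution that has a single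
  nonzero coefficient shows that there is no other.
\<close>

lemma xray_adjoint_fourier:
  assumes Q: "direction_set Q" and g: "g \<in> sobolevQ Q r"
  shows "xray_adjoint Q r g \<in> sobolev r" "fourier (xray_adjoint Q r g) k = perp_coef Q g k"
proof -
  obtain h where h: "h \<in> sobolev r" "\<And>k. fourier h k = perp_coef Q g k"
    using sobolev_with_fourier[OF sobolevQ_perp_coef_summable(1)[OF Q g]] by blast
  have "xray_adjoint Q r g = h"
    unfolding xray_adjoint_def
  proof (rule the_equality)
    show "h \<in> sobolev r \<and> (\<forall>f\<in>sobolev r. sobolevQ_inner Q r (xray Q f) g = sobolev_inner r f h)"
      using h by (simp add: sobolevQ_inner_xray[OF Q _ g] sobolev_inner_def)
  next
    fix h' assume h': "h' \<in> sobolev r \<and> (\<forall>f\<in>sobolev r. sobolevQ_inner Q r (xray Q f) g = sobolev_inner r f h')"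
    have "fourier h' j = fourier h j" for j
    proof -
      \<comment> \<open>Coefficients of the test distribution that isolates the frequency \<open>j\<close>.\<close>
      define c where "c k = (if k = j then 1 else 0 :: complex)" for k
      have "(\<lambda>k. jbracket k powr (2 * r) * (cmod (c k))\<^sup>2) summable_on {j}"
        by simp
      then have "(\<lambda>k. jbracket k powr (2 * r) * (cmod (c k))\<^sup>2) summable_on UNIV"
        by (rule summable_on_cong_neutral[THEN iffD1, rotated 3]) (auto simp: c_def)
      then obtain e where e: "e \<in> sobolev r" "\<And>k. fourier e k = c k"
        using sobolev_with_fourier by blast
      have single: "(\<Sum>\<^sub>\<infinity>k. complex_of_real (jbracket k powr (2 * r)) * c k * cnj (d k))
          = complex_of_real (jbracket j powr (2 * r)) * cnj (d j)" for d
      proof -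
        have "(\<Sum>\<^sub>\<infinity>k. complex_of_real (jbracket k powr (2 * r)) * c k * cnj (d k))
            = (\<Sum>\<^sub>\<infinity>k\<in>{j}. complex_of_real (jbracket k powr (2 * r)) * c k * cnj (d k))"
          by (rule infsum_cong_neutral) (auto simp: c_def)
        then show ?thesis by (simp add: c_def)
      qed
      have "sobolevQ_inner Q r (xray Q e) g = sobolev_inner r e h'"
        using h' e(1) by blast
      then have "complex_of_real (jbracket j powr (2 * r)) * cnj (perp_coef Q g j)
          = complex_of_real (jbracket j powr (2 * r)) * cnj (fourier h' j)"
        by (simp only: sobolevQ_inner_xray[OF Q e(1) g] sobolev_inner_def e(2) single)
      moreover have "complex_of_real (jbracket j powr (2 * r)) \<noteq> 0"
        using jbracket_powr_pos[of j "2 * r"] by (metis of_real_eq_0_iff less_irrefl)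
      ultimately have "cnj (perp_coef Q g j) = cnj (fourier h' j)"
        by (simp only: mult_cancel_left) simp
      then show ?thesis using h(2) by simp
    qed
    then show "h' = h" using h' h(1) by (intro distribution_eqI) (auto simp: sobolev_iff)
  qed
  with h show "xray_adjoint Q r g \<in> sobolev r" "fourier (xray_adjoint Q r g) k = perp_coef Q g k"
    by simp_all
qed

section \<open>The regularising multiplier\<close>

lemma P_op_fourier:
  assumes a: "\<alpha> > 0" and f: "f \<in> sobolev r"
  shows "P_op \<sigma> \<alpha> f \<in> distributions"
    "fourier (P_op \<sigma> \<alpha> f) k = complex_of_real (inverse (1 + \<alpha> * jbracket k powr (2 * \<sigma>))) * fourier f k"
proof -
  let ?m = "\<lambda>k. complex_of_real (inverse (1 + \<alpha> * jbracket k powr (2 * \<sigma>))) * fourier f k"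
  have le: "cmod (?m k) \<le> cmod (fourier f k)" for k
  proof -
    have "0 \<le> \<alpha> * jbracket k powr (2 * \<sigma>)" using a by simp
    then have "\<bar>inverse (1 + \<alpha> * jbracket k powr (2 * \<sigma>))\<bar> \<le> 1"
      by (simp add: inverse_le_1_iff)
    from mult_right_mono[OF this norm_ge_zero[of "fourier f k"]]
    show ?thesis by (simp only: norm_mult norm_of_real mult_1_left)
  qed
  have sum: "(\<lambda>k. jbracket k powr (2 * r) * (cmod (?m k))\<^sup>2) summable_on UNIV"
  proof (rule summable_on_comparison_test)
    show "(\<lambda>k. jbracket k powr (2 * r) * (cmod (fourier f k))\<^sup>2) summable_on UNIV"
      using f by (simp add: sobolev_iff)
    show "jbracket k powr (2 * r) * (cmod (?m k))\<^sup>2 \<le> jbracket k powr (2 * r) * (cmod (fourier f k))\<^sup>2" for k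
      by (intro mult_left_mono power_mono le) auto
  qed simp
  obtain h where h: "h \<in> sobolev r" "\<And>k. fourier h k = ?m k"
    using sobolev_with_fourier[of r ?m, OF sum] by blast
  have "P_op \<sigma> \<alpha> f = h"
    unfolding P_op_def using h
    by (intro the_equality) (auto simp: sobolev_iff intro: distribution_eqI)
  with h show "P_op \<sigma> \<alpha> f \<in> distributions" "fourier (P_op \<sigma> \<alpha> f) k = ?m k"
    by (simp_all add: sobolev_iff)
qed

text \<open>
  The symbol is at most \<open>\<alpha>\<^bsup>-1\<^esup> \<langle>k\<rangle>\<^bsup>-2\<sigma>\<^esup>\<close>, which buys \<open>2 \<sigma>\<close> derivatives.
\<close>

lemma P_op_sobolev:
  assumes a: "\<alpha> > 0" and f: "f \<in> sobolev r"
  shows "P_op \<sigma> \<alpha> f \<in> sobolev (r + 2 * \<sigma>)"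
  unfolding sobolev_iff
proof (intro conjI P_op_fourier(1)[OF a f], rule summable_on_comparison_test)
  show "(\<lambda>k. inverse (\<alpha>\<^sup>2) * (jbracket k powr (2 * r) * (cmod (fourier f k))\<^sup>2)) summable_on UNIV"
    using f by (intro summable_on_cmult_right) (simp add: sobolev_iff)
  fix k
  define J where "J = jbracket k powr (2 * \<sigma>)"
  have J: "J > 0" by (simp only: J_def jbracket_powr_pos)
  have "jbracket k powr (2 * (r + 2 * \<sigma>)) = jbracket k powr (2 * r) * J\<^sup>2"
    by (simp add: J_def power2_eq_square distrib_left powr_add[symmetric])
  moreover have "J\<^sup>2 * (inverse (1 + \<alpha> * J))\<^sup>2 \<le> inverse (\<alpha>\<^sup>2)"
  proof -
    have "0 < 1 + \<alpha> * J" using J a by (intro add_pos_pos mult_pos_pos) auto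
    moreover have "J \<le> inverse \<alpha> * (1 + \<alpha> * J)" using a by (simp add: distrib_left mult.assoc[symmetric])
    ultimately have "J * inverse (1 + \<alpha> * J) \<le> inverse \<alpha>"
      by (simp only: divide_inverse[symmetric] pos_divide_le_eq)
    then have "(J * inverse (1 + \<alpha> * J))\<^sup>2 \<le> (inverse \<alpha>)\<^sup>2"
      using J a by (intro power_mono) auto
    then show ?thesis by (simp only: power_mult_distrib power_inverse)
  qed
  then have "(J\<^sup>2 * (inverse (1 + \<alpha> * J))\<^sup>2) * (jbracket k powr (2 * r) * (cmod (fourier f k))\<^sup>2)
      \<le> inverse (\<alpha>\<^sup>2) * (jbracket k powr (2 * r) * (cmod (fourier f k))\<^sup>2)"
    by (rule mult_right_mono) simp
  moreover have "(cmod (fourier (P_op \<sigma> \<alpha> f) k))\<^sup>2 = (inverse (1 + \<alpha> * J))\<^sup>2 * (cmod (fourier f k))\<^sup>2"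
    by (simp only: P_op_fourier(2)[OF a f] norm_mult norm_of_real power_mult_distrib power2_abs J_def)
  ultimately show "jbracket k powr (2 * (r + 2 * \<sigma>)) * (cmod (fourier (P_op \<sigma> \<alpha> f) k))\<^sup>2
      \<le> inverse (\<alpha>\<^sup>2) * (jbracket k powr (2 * r) * (cmod (fourier f k))\<^sup>2)"
    by (simp only: mult.assoc mult.left_commute mult.commute)
qed simp

section \<open>The minimiser\<close>

lemma complete_square:
  fixes z b :: complex and A B :: real
  assumes "A > 0" "B > 0"
  shows "A * (cmod (z - b))\<^sup>2 + B * (cmod z)\<^sup>2 =
    (A + B) * (cmod (z - complex_of_real (A / (A + B)) * b))\<^sup>2 + A * B / (A + B) * (cmod b)\<^sup>2"
proof -
  have AB: "A + B \<noteq> 0" using assms by simp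
  \<comment> \<open>The identity holds for real and imaginary parts separately.\<close>
  have real: "A * (x - y)\<^sup>2 + B * x\<^sup>2 = (A + B) * (x - A / (A + B) * y)\<^sup>2 + A * B / (A + B) * y\<^sup>2" for x y :: real
  proof -
    have "(A + B) * (A * (x - y)\<^sup>2 + B * x\<^sup>2) = ((A + B) * x - A * y)\<^sup>2 + A * B * y\<^sup>2"
      by (simp add: power2_eq_square algebra_simps)
    moreover have "(A + B) * x - A * y = (A + B) * (x - A / (A + B) * y)"
      using AB by (simp add: right_diff_distrib)
    ultimately have "(A + B) * (A * (x - y)\<^sup>2 + B * x\<^sup>2)
        = (A + B) * ((A + B) * (x - A / (A + B) * y)\<^sup>2 + A * B / (A + B) * y\<^sup>2)"
      using AB by (simp add: distrib_left power_mult_distrib power2_eq_square mult.assoc)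
    then show ?thesis using AB by (simp only: mult_cancel_left) simp
  qed
  show ?thesis
    using real[of "Re z" "Re b"] real[of "Im z" "Im b"]
    by (simp only: cmod_power2 minus_complex.sel Re_complex_of_real Im_complex_of_real times_complex.sel
        mult_zero_left diff_zero add_0_right distrib_left)
qed

text \<open>
  The constant collects the unreachable part of the data and the remainders
  \<open>A B / (A + B) |b|\<^sup>2\<close> of the completed squares. It is finite because \<open>A B / (A + B) \<le> A\<close> and
  \<open>g\<close> has finite norm; finiteness is what allows it to be cancelled when minimisers are compared.
\<close>

lemma tikhonov_complete_square:
  assumes Q: "direction_set Q" and a: "\<alpha> > 0" and g: "g \<in> sobolevQ Q r"
  obtains C where "C < \<infinity>"
    "\<And>f. f \<in> distributions \<Longrightarrow> tikhonov Q r s \<alpha> g f =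
      (\<Sum>\<^sub>\<infinity>k. ennreal ((jbracket k powr (2 * r) + \<alpha> * jbracket k powr (2 * s)) *
        (cmod (fourier f k - fourier (P_op (s - r) \<alpha> (xray_adjoint Q r g)) k))\<^sup>2)) + C"
proof -
  define A where "A k = jbracket k powr (2 * r)" for k
  define B where "B k = \<alpha> * jbracket k powr (2 * s)" for k
  define b where "b = perp_coef Q g"
  define m where "m = fourier (P_op (s - r) \<alpha> (xray_adjoint Q r g))"
  define D where "D = (\<Sum>\<^sub>\<infinity>k. ennreal (A k * B k / (A k + B k) * (cmod (b k))\<^sup>2))"
  have A: "A k > 0" and B: "B k > 0" for k
    using a by (auto simp only: A_def B_def jbracket_powr_pos intro!: mult_pos_pos)
  \<comment> \<open>\<open>B = A \<alpha> \<langle>k\<rangle>\<^bsup>2(s-r)\<^esup>\<close>, so the multiplier \<open>P_op\<close> is the weight that minimises each summand.\<close>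
  have m: "m k = complex_of_real (A k / (A k + B k)) * b k" for k
  proof -
    have "B k = A k * (\<alpha> * jbracket k powr (2 * (s - r)))"
      by (simp add: A_def B_def mult.left_commute powr_add[symmetric] right_diff_distrib)
    then have "A k + B k = A k * (1 + \<alpha> * jbracket k powr (2 * (s - r)))"
      by (simp only: distrib_left mult_1_right)
    then have "A k / (A k + B k) = inverse (1 + \<alpha> * jbracket k powr (2 * (s - r)))"
      using A[of k] by (simp add: divide_inverse)
    then show ?thesis
      by (simp only: m_def b_def P_op_fourier(2)[OF a xray_adjoint_fourier(1)[OF Q g]]
          xray_adjoint_fourier(2)[OF Q g])
  qed
  have "(\<lambda>k. A k * B k / (A k + B k) * (cmod (b k))\<^sup>2) summable_on UNIV"
  proof (rule summable_on_comparison_test)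
    show "(\<lambda>k. A k * (cmod (b k))\<^sup>2) summable_on UNIV"
      unfolding A_def b_def by (rule sobolevQ_perp_coef_summable(1)[OF Q g])
    fix k
    have "A k * B k / (A k + B k) \<le> A k"
      using A[of k] B[of k] by (simp add: pos_divide_le_eq)
    then show "A k * B k / (A k + B k) * (cmod (b k))\<^sup>2 \<le> A k * (cmod (b k))\<^sup>2"
      by (rule mult_right_mono) simp
    show "0 \<le> A k * B k / (A k + B k) * (cmod (b k))\<^sup>2"
      using A[of k] B[of k] by simp
  qed
  then have "D < \<infinity>"
    unfolding D_def using A B by (subst infsum_ennreal_finite_iff) (auto simp: less_imp_le add_nonneg_nonneg)
  then have fin: "D + offperp_normsq Q r g < \<infinity>"
    using sobolevQ_perp_coef_summable(2)[OF Q g] by simp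
  have "tikhonov Q r s \<alpha> g f =
      (\<Sum>\<^sub>\<infinity>k. ennreal ((A k + B k) * (cmod (fourier f k - m k))\<^sup>2)) + (D + offperp_normsq Q r g)"
    if f: "f \<in> distributions" for f
  proof -
    have "ennreal \<alpha> * sobolev_normsq s f = (\<Sum>\<^sub>\<infinity>k. ennreal (B k * (cmod (fourier f k))\<^sup>2))"
      unfolding sobolev_normsq_def B_def using a
      by (simp add: infsum_ennreal_cmult[symmetric] ennreal_mult'[symmetric] mult.assoc)
    then have "tikhonov Q r s \<alpha> g f =
        (\<Sum>\<^sub>\<infinity>k. ennreal (A k * (cmod (fourier f k - b k))\<^sup>2)) +
        (\<Sum>\<^sub>\<infinity>k. ennreal (B k * (cmod (fourier f k))\<^sup>2)) + offperp_normsq Q r g"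
      unfolding tikhonov_def sobolevQ_normsq_xray_diff[OF Q f g] A_def b_def
      by (simp only: ac_simps)
    also have "(\<Sum>\<^sub>\<infinity>k. ennreal (A k * (cmod (fourier f k - b k))\<^sup>2)) +
        (\<Sum>\<^sub>\<infinity>k. ennreal (B k * (cmod (fourier f k))\<^sup>2)) =
        (\<Sum>\<^sub>\<infinity>k. ennreal (A k * (cmod (fourier f k - b k))\<^sup>2) + ennreal (B k * (cmod (fourier f k))\<^sup>2))"
      by (rule infsum_add[OF ennreal_summable_on ennreal_summable_on, symmetric])
    also have "\<dots> = (\<Sum>\<^sub>\<infinity>k. ennreal ((A k + B k) * (cmod (fourier f k - m k))\<^sup>2) +
        ennreal (A k * B k / (A k + B k) * (cmod (b k))\<^sup>2))"
    proof (rule infsum_cong)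
      fix k
      have nn: "0 \<le> A k * (cmod (fourier f k - b k))\<^sup>2" "0 \<le> B k * (cmod (fourier f k))\<^sup>2"
        "0 \<le> (A k + B k) * (cmod (fourier f k - m k))\<^sup>2" "0 \<le> A k * B k / (A k + B k) * (cmod (b k))\<^sup>2"
        using A[of k] B[of k] by simp_all
      have "ennreal (A k * (cmod (fourier f k - b k))\<^sup>2) + ennreal (B k * (cmod (fourier f k))\<^sup>2) =
          ennreal (A k * (cmod (fourier f k - b k))\<^sup>2 + B k * (cmod (fourier f k))\<^sup>2)"
        by (rule ennreal_plus[OF nn(1,2), symmetric])
      also have "\<dots> = ennreal ((A k + B k) * (cmod (fourier f k - m k))\<^sup>2 + A k * B k / (A k + B k) * (cmod (b k))\<^sup>2)"
        by (simp only: m complete_square[OF A B])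
      also have "\<dots> = ennreal ((A k + B k) * (cmod (fourier f k - m k))\<^sup>2) +
          ennreal (A k * B k / (A k + B k) * (cmod (b k))\<^sup>2)"
        by (rule ennreal_plus[OF nn(3,4)])
      finally show "ennreal (A k * (cmod (fourier f k - b k))\<^sup>2) + ennreal (B k * (cmod (fourier f k))\<^sup>2) =
          ennreal ((A k + B k) * (cmod (fourier f k - m k))\<^sup>2) +
          ennreal (A k * B k / (A k + B k) * (cmod (b k))\<^sup>2)" .
    qed
    also have "\<dots> = (\<Sum>\<^sub>\<infinity>k. ennreal ((A k + B k) * (cmod (fourier f k - m k))\<^sup>2)) + D"
      unfolding D_def by (rule infsum_add[OF ennreal_summable_on ennreal_summable_on])
    finally show ?thesis by (simp only: add.assoc)
  qed
  from that[OF fin this[unfolded A_def B_def m_def]] show ?thesis .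
qed

theorem theorem4p7:
  fixes r s \<alpha> :: real
    and Q :: "(int \<times> int) set"
    and g :: family
  assumes "direction_set Q"
    and "s \<ge> r"
    and "\<alpha> > 0"
    and "g \<in> sobolevQ Q r"
  shows "(\<exists>!f. is_arg_min (tikhonov Q r s \<alpha> g) (\<lambda>f. f \<in> sobolev r) f) \<and>
    is_arg_min (tikhonov Q r s \<alpha> g) (\<lambda>f. f \<in> sobolev r) (P_op (s - r) \<alpha> (xray_adjoint Q r g)) \<and>
    P_op (s - r) \<alpha> (xray_adjoint Q r g) \<in> sobolev (2 * s - r) \<and>
    sobolev (2 * s - r) \<subseteq> sobolev s"
proof -
  let ?F = "tikhonov Q r s \<alpha> g"
  define p where "p = P_op (s - r) \<alpha> (xray_adjoint Q r g)"
  define w where "w k = jbracket k powr (2 * r) + \<alpha> * jbracket k powr (2 * s)" for k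
  have w: "w k > 0" for k
    unfolding w_def using assms(3) by (intro add_pos_pos mult_pos_pos jbracket_powr_pos)
  obtain C where C: "C < \<infinity>" "\<And>f. f \<in> distributions \<Longrightarrow>
      ?F f = (\<Sum>\<^sub>\<infinity>k. ennreal (w k * (cmod (fourier f k - fourier p k))\<^sup>2)) + C"
    unfolding w_def p_def using tikhonov_complete_square[OF assms(1,3,4)] by blast
  have "P_op (s - r) \<alpha> (xray_adjoint Q r g) \<in> sobolev (r + 2 * (s - r))"
    by (rule P_op_sobolev[OF assms(3) xray_adjoint_fourier(1)[OF assms(1,4)]])
  then have p1: "p \<in> sobolev (2 * s - r)" by (simp add: p_def)
  have p2: "p \<in> sobolev r"
    using p1 sobolev_mono[of r "2 * s - r"] assms(2) by auto
  have dist: "f \<in> distributions" if "f \<in> sobolev r" for f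
    using that by (simp add: sobolev_iff)
  have Fp: "?F p = C"
    using C(2)[OF dist[OF p2]] by simp
  have min: "is_arg_min ?F (\<lambda>f. f \<in> sobolev r) p"
    unfolding is_arg_min_def Fp using p2 C(2) dist by (auto simp: not_less)
  have "f = p" if "is_arg_min ?F (\<lambda>f. f \<in> sobolev r) f" for f
  proof -
    have f: "f \<in> sobolev r" "?F f \<le> C"
      using that p2 Fp by (auto simp: is_arg_min_def not_less)
    have "(\<Sum>\<^sub>\<infinity>k. ennreal (w k * (cmod (fourier f k - fourier p k))\<^sup>2)) + C \<le> 0 + C"
      using f(2) C(2)[OF dist[OF f(1)]] by simp
    then have "(\<Sum>\<^sub>\<infinity>k. ennreal (w k * (cmod (fourier f k - fourier p k))\<^sup>2)) = 0"
      using C(1) by (auto simp: ennreal_add_left_cancel_le add.commute)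
    then have zero: "ennreal (w k * (cmod (fourier f k - fourier p k))\<^sup>2) = 0" for k
      using infsum_ennreal_single_le[of k UNIV "\<lambda>k. ennreal (w k * (cmod (fourier f k - fourier p k))\<^sup>2)"]
      by simp
    have "fourier f k = fourier p k" for k
      using zero[of k] w[of k] by (simp add: ennreal_eq_0_iff mult_le_0_iff)
    then show ?thesis
      by (intro distribution_eqI dist f(1) p2)
  qed
  with min have "\<exists>!f. is_arg_min ?F (\<lambda>f. f \<in> sobolev r) f" by blast
  then show ?thesis
    using min p1 sobolev_mono[of s "2 * s - r"] assms(2) unfolding p_def by auto
qed


end
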